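(* Let $G$ be a cograph minimal $(\infty,2)$-polar obstruction. Then: (1) $G$ is connected if and only if $\overline{G} \cong P_3 + H$, where $H$ is isomorphic to $K_1 \oplus C_4$, $\overline{2P_3}$, $K_2 \oplus 2K_2$, or $K_1 \oplus (K_2 + P_3)$; (2) $G$ is disconnected and has no isolated vertices if and only if $G$ is isomorphic to $P_3 + C_4$, $P_3 + (K_1 \oplus 2K_2)$, or $2P_3 + K_2$; (3) $G$ has exactly $4$ connected components if and only if $G$ is isomorphic to $3K_1 + (K_1 \oplus C_4)$ or to $pK_1 + (3-p)K_2 + K_{p,p}$ for some $p \in \{1,2,3\}$; (4) $G$ has exactly $3$ connected components and at least one isolated vertex if and only if $G$ is isomorphic to $2K_1 + \overline{2P_3}$, $2K_1 + (K_1 \oplus (P_3+K_2))$, $2K_1 + (K_2 \oplus 2K_2)$, $2K_1 + (K_1 \oplus (C_4 + K_1))$, $2K_1 + (K_1 \oplus \overline{P_3 + K_2})$, $2K_1 + (\overline{K_2} \oplus (P_3 + K_1))$, or $pK_1 + (2-p)K_2 + (2K_1 \oplus (K_2 + pK_1))$ for some $p \in \{1,2\}$; (5) $G$ has exactly $2$ connected components and one isolated vertex if and only if $G$ is isomorphic to $K_1 + (K_1 \oplus (K_1 + 2K_2))$, $K_1 + (K_1 \oplus (2K_1 + C_4))$, $K_1 + (K_1 \oplus 2P_3)$, or $K_1 + (K_1 \oplus (K_1 + \overline{K_2 + P_3}))$. In conclusion, a graph $G$ is a cograph minimal $(\infty,2)$-polar obstruction if and only if it is isomorphic to one of the $23$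 cographs listed above.
   Context: All graphs are finite and simple. A cograph is a graph with no induced subgraph isomorphic to $P_4$. $G+H$ denotes disjoint union, $G \oplus H$ the join (disjoint union plus all edges between $G$ and $H$), $nG$ the disjoint union of $n$ copies of $G$ ($0G$ is the empty graph), $\overline{G}$ the complement of $G$; $K_n$, $P_n$, $C_n$ are the complete graph, path and cycle on $n$ vertices and $K_{p,q}$ the complete bipartite graph. A cluster is a disjoint union of complete graphs. For $s,k \in \mathbb{Z}_{\ge 0}\cup\{\infty\}$, an $(s,k)$-polar partition of $G$ is a partition $(A,B)$ of $V(G)$ (parts may be empty) such that $G[A]$ is a complete multipartite graph with at most $s$ parts and $G[B]$ is a cluster with at most $k$ components; $\infty$ means unbounded. $G$ is $(s,k)$-polar if it has such a partition. A cograph minimal $(s,k)$-polar obstruction is a cograph that is not $(s,k)$-polar but all of whose proper induced subgraphs are $(s,k)$-polar. *)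

theory Defs
  imports "HOL-Library.Extended_Nat" "HOL-Library.Disjoint_Sets"
begin

text \<open>An undirected edge \<open>uv\<close> is represented by the two pairs \<open>(u, v)\<close> and \<open>(v, u)\<close>.\<close>

datatype 'a sgraph = SGraph (verts: "'a set") (edges: "'a rel")

definition simple_graph :: "'a sgraph \<Rightarrow> bool" where
  "simple_graph G \<longleftrightarrow>
     finite (verts G) \<and> edges G \<subseteq> verts G \<times> verts G \<and> sym (edges G) \<and> irrefl (edges G)"

definition isomorphic :: "'a sgraph \<Rightarrow> 'b sgraph \<Rightarrow> bool" (infix "\<cong>" 50) where
  "G \<cong> H \<longleftrightarrow>
     (\<exists>f. bij_betw f (verts G) (verts H) \<and>
          (\<forall>u\<in>verts G. \<forall>v\<in>verts G. (u, v) \<in> edges G \<longleftrightarrow> (f u, f v) \<in> edges H))"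

definition induced :: "'a sgraph \<Rightarrow> 'a set \<Rightarrow> 'a sgraph" where
  "induced G W = SGraph W (edges G \<inter> W \<times> W)"

definition complement :: "'a sgraph \<Rightarrow> 'a sgraph" where
  "complement G = SGraph (verts G) {(u, v) \<in> verts G \<times> verts G. u \<noteq> v \<and> (u, v) \<notin> edges G}"

definition components :: "'a sgraph \<Rightarrow> 'a set set" where
  "components G = verts G // {(u, v) \<in> verts G \<times> verts G. (u, v) \<in> (edges G)\<^sup>*}"

definition connected_graph :: "'a sgraph \<Rightarrow> bool" where
  "connected_graph G \<longleftrightarrow>
     verts G \<noteq> {} \<and> (\<forall>u\<in>verts G. \<forall>v\<in>verts G. (u, v) \<in> (edges G)\<^sup>*)"

definition isolated_verts :: "'a sgraph \<Rightarrow> 'a set" where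
  "isolated_verts G = {v \<in> verts G. \<forall>u\<in>verts G. (v, u) \<notin> edges G}"


text \<open>
  Disjoint union and join are formed on natural-number vertices, so that all concrete graphs
  below have the same type: the vertices of the left operand are moved to the even numbers and
  those of the right operand to the odd numbers.
\<close>

definition disjoint_union :: "nat sgraph \<Rightarrow> nat sgraph \<Rightarrow> nat sgraph" (infixl "\<uplus>" 65) where
  "G \<uplus> H = SGraph ((\<lambda>u. 2 * u) ` verts G \<union> (\<lambda>u. 2 * u + 1) ` verts H)
     ((\<lambda>(u, v). (2 * u, 2 * v)) ` edges G \<union> (\<lambda>(u, v). (2 * u + 1, 2 * v + 1)) ` edges H)"

definition join :: "nat sgraph \<Rightarrow> nat sgraph \<Rightarrow> nat sgraph" (infixl "\<oplus>" 65) where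
  "G \<oplus> H =
     (let A = (\<lambda>u. 2 * u) ` verts G; B = (\<lambda>u. 2 * u + 1) ` verts H
      in SGraph (verts (G \<uplus> H)) (edges (G \<uplus> H) \<union> A \<times> B \<union> B \<times> A))"

primrec copies :: "nat \<Rightarrow> nat sgraph \<Rightarrow> nat sgraph" (infixr "\<cdot>" 70) where
  "0 \<cdot> G = SGraph {} {}"
| "Suc n \<cdot> G = G \<uplus> n \<cdot> G"

definition Kn :: "nat \<Rightarrow> nat sgraph" where
  "Kn n = SGraph {..<n} {(u, v) \<in> {..<n} \<times> {..<n}. u \<noteq> v}"

definition Pn :: "nat \<Rightarrow> nat sgraph" where
  "Pn n = SGraph {..<n} {(u, v) \<in> {..<n} \<times> {..<n}. v = Suc u \<or> u = Suc v}"

text \<open>Only meaningful for \<open>n \<ge> 3\<close>.\<close>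
definition Cn :: "nat \<Rightarrow> nat sgraph" where
  "Cn n = SGraph {..<n} {(u, v) \<in> {..<n} \<times> {..<n}. v = Suc u mod n \<or> u = Suc v mod n}"

definition Kpq :: "nat \<Rightarrow> nat \<Rightarrow> nat sgraph" where
  "Kpq p q = SGraph {..<p + q} {(u, v) \<in> {..<p + q} \<times> {..<p + q}. (u < p) \<noteq> (v < p)}"


definition cograph :: "'a sgraph \<Rightarrow> bool" where
  "cograph G \<longleftrightarrow> simple_graph G \<and> \<not> (\<exists>W\<subseteq>verts G. induced G W \<cong> Pn 4)"

definition complete_graph :: "'a sgraph \<Rightarrow> bool" where
  "complete_graph G \<longleftrightarrow> (\<forall>u\<in>verts G. \<forall>v\<in>verts G. u \<noteq> v \<longrightarrow> (u, v) \<in> edges G)"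

definition cluster :: "'a sgraph \<Rightarrow> bool" where
  "cluster G \<longleftrightarrow> (\<forall>W\<in>components G. complete_graph (induced G W))"

definition complete_multipartite_at_most :: "enat \<Rightarrow> 'a sgraph \<Rightarrow> bool" where
  "complete_multipartite_at_most s G \<longleftrightarrow>
     (\<exists>\<P>. partition_on (verts G) \<P> \<and> enat (card \<P>) \<le> s \<and>
          (\<forall>u\<in>verts G. \<forall>v\<in>verts G. (u, v) \<in> edges G \<longleftrightarrow> \<not> (\<exists>X\<in>\<P>. u \<in> X \<and> v \<in> X)))"

definition polar_partition :: "enat \<Rightarrow> enat \<Rightarrow> 'a sgraph \<Rightarrow> 'a set \<Rightarrow> 'a set \<Rightarrow> bool" where
  "polar_partition s k G A B \<longleftrightarrow>
     A \<union> B = verts G \<and> A \<inter> B = {} \<and>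
     complete_multipartite_at_most s (induced G A) \<and>
     cluster (induced G B) \<and> enat (card (components (induced G B))) \<le> k"

definition polar :: "enat \<Rightarrow> enat \<Rightarrow> 'a sgraph \<Rightarrow> bool" where
  "polar s k G \<longleftrightarrow> (\<exists>A B. polar_partition s k G A B)"

definition cograph_minimal_polar_obstruction :: "enat \<Rightarrow> enat \<Rightarrow> 'a sgraph \<Rightarrow> bool" where
  "cograph_minimal_polar_obstruction s k G \<longleftrightarrow>
     cograph G \<and> \<not> polar s k G \<and> (\<forall>W\<subset>verts G. polar s k (induced G W))"


definition connected_summands :: "nat sgraph set" where
  "connected_summands =
     {Kn 1 \<oplus> Cn 4, complement (2 \<cdot> Pn 3), Kn 2 \<oplus> 2 \<cdot> Kn 2, Kn 1 \<oplus> (Kn 2 \<uplus> Pn 3)}"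

definition no_isolated_list :: "nat sgraph set" where
  "no_isolated_list = {Pn 3 \<uplus> Cn 4, Pn 3 \<uplus> (Kn 1 \<oplus> 2 \<cdot> Kn 2), 2 \<cdot> Pn 3 \<uplus> Kn 2}"

definition four_components_list :: "nat sgraph set" where
  "four_components_list =
     {3 \<cdot> Kn 1 \<uplus> (Kn 1 \<oplus> Cn 4)} \<union>
     {p \<cdot> Kn 1 \<uplus> (3 - p) \<cdot> Kn 2 \<uplus> Kpq p p | p. p \<in> {1, 2, 3}}"

definition three_components_list :: "nat sgraph set" where
  "three_components_list =
     {2 \<cdot> Kn 1 \<uplus> complement (2 \<cdot> Pn 3),
      2 \<cdot> Kn 1 \<uplus> (Kn 1 \<oplus> (Pn 3 \<uplus> Kn 2)),
      2 \<cdot> Kn 1 \<uplus> (Kn 2 \<oplus> 2 \<cdot> Kn 2),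
      2 \<cdot> Kn 1 \<uplus> (Kn 1 \<oplus> (Cn 4 \<uplus> Kn 1)),
      2 \<cdot> Kn 1 \<uplus> (Kn 1 \<oplus> complement (Pn 3 \<uplus> Kn 2)),
      2 \<cdot> Kn 1 \<uplus> (complement (Kn 2) \<oplus> (Pn 3 \<uplus> Kn 1))} \<union>
     {p \<cdot> Kn 1 \<uplus> (2 - p) \<cdot> Kn 2 \<uplus> (2 \<cdot> Kn 1 \<oplus> (Kn 2 \<uplus> p \<cdot> Kn 1)) | p. p \<in> {1, 2}}"

definition two_components_list :: "nat sgraph set" where
  "two_components_list =
     {Kn 1 \<uplus> (Kn 1 \<oplus> (Kn 1 \<uplus> 2 \<cdot> Kn 2)),
      Kn 1 \<uplus> (Kn 1 \<oplus> (2 \<cdot> Kn 1 \<uplus> Cn 4)),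
      Kn 1 \<uplus> (Kn 1 \<oplus> 2 \<cdot> Pn 3),
      Kn 1 \<uplus> (Kn 1 \<oplus> (Kn 1 \<uplus> complement (Kn 2 \<uplus> Pn 3)))}"

definition obstruction_list :: "nat sgraph set" where
  "obstruction_list =
     (\<lambda>H. complement (Pn 3 \<uplus> H)) ` connected_summands \<union> no_isolated_list \<union>
     four_components_list \<union> three_components_list \<union> two_components_list"

end

theory Submission
  imports Defs
begin

text \<open>
  Whether a cograph \<open>W\<close> is \<open>(\<infinity>, 2)\<close>-polar is determined by a state that is computed along its cotree:
  the least number of cliques (truncated at 3) needed to cover \<open>W - A\<close> by a cluster when \<open>A\<close> is
  empty, independent, or complete multipartite. Call a cograph critical if deleting any vertex
  changes its state. Minimal obstructions are critical, and since states are compositional both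
  operands of a union or join that is critical are critical. Up to isomorphism
  there are only 47 critical polar cographs, so every minimal obstruction is a
  union or join of two of these, and a finite computation leaves exactly the 23 listed graphs.
\<close>

section \<open>Cotrees\<close>

text \<open>Three shapes of \<open>A\<close> are needed because the two operations turn them into
  one another: a complete multipartite set that meets both sides of a disjoint union is independent
  on each side, and an independent set in a join is empty on one side. The cut at 3 is harmless,
  since a remainder covered by at most two cliques leaves each operand with a remainder covered by
  at most two. Hence there are finitely many states, and unions and joins act on them by the fixed
  table \<open>combine\<close>. If deleting \<open>x\<close> from one operand kept the state of that
  operand, the table would keep the state of the whole; this is why operands of critical sets are
  critical. Operands of a minimal obstruction are proper subsets of it, hence polar. Binary cotrees
  are not unique. Normal forms serve only to recognise equal graphs, never to tell graphs apart, so
  it is enough that a normal form realizes the same graph. Non-isomorphism comes from degree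
  sequences instead.\<close>

datatype cotree = Leaf | Node bool cotree cotree

abbreviation (input) Par :: "cotree \<Rightarrow> cotree \<Rightarrow> cotree" where "Par \<equiv> Node False"
abbreviation (input) Ser :: "cotree \<Rightarrow> cotree \<Rightarrow> cotree" where "Ser \<equiv> Node True"

text \<open>Both orientations are demanded, so that \<open>cross\<close> is symmetric in
  \<open>U\<close> and \<open>V\<close> even where \<open>E\<close> is not known to be
  symmetric.\<close>

definition cross :: "'a rel \<Rightarrow> bool \<Rightarrow> 'a set \<Rightarrow> 'a set \<Rightarrow> bool" where
  "cross E b U V \<longleftrightarrow>
     U \<inter> V = {} \<and> (\<forall>u\<in>U. \<forall>v\<in>V. ((u, v) \<in> E \<longleftrightarrow> b) \<and> ((v, u) \<in> E \<longleftrightarrow> b))"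

text \<open>A relation on vertex sets inside one fixed \<open>E\<close>: induced subgraphs are then
  just smaller sets. A cotree never describes the empty graph, and nested nodes may carry equal
  labels.\<close>

primrec realizes :: "cotree \<Rightarrow> 'a rel \<Rightarrow> 'a set \<Rightarrow> bool" where
  "realizes Leaf E W \<longleftrightarrow> (\<exists>x. W = {x} \<and> (x, x) \<notin> E)"
| "realizes (Node b s t) E W \<longleftrightarrow>
     (\<exists>U V. W = U \<union> V \<and> cross E b U V \<and> realizes s E U \<and> realizes t E V)"

declare realizes.simps(2) [simp del]

lemma realizes_NodeE:
  assumes "realizes (Node b s t) E W"
  obtains U V where "W = U \<union> V" "cross E b U V" "realizes s E U" "realizes t E V"
  using assms by (auto simp: realizes.simps(2))

lemma cross_commute: "cross E b U V \<longleftrightarrow> cross E b V U"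
  by (auto simp: cross_def)

lemma cross_Un_left: "cross E b (U \<union> U') V \<longleftrightarrow> cross E b U V \<and> cross E b U' V"
  by (auto simp: cross_def)

lemma cross_Un_right: "cross E b U (V \<union> V') \<longleftrightarrow> cross E b U V \<and> cross E b U V'"
  by (auto simp: cross_def)

lemma cross_mono: "cross E b U V \<Longrightarrow> U' \<subseteq> U \<Longrightarrow> V' \<subseteq> V \<Longrightarrow> cross E b U' V'"
  unfolding cross_def by blast

lemma realizes_finite: "realizes t E W \<Longrightarrow> finite W"
  by (induction t arbitrary: W) (auto elim: realizes_NodeE)

lemma realizes_nonempty: "realizes t E W \<Longrightarrow> W \<noteq> {}"
  by (induction t arbitrary: W) (auto elim: realizes_NodeE)

lemma realizes_NodeI:
  "cross E b U V \<Longrightarrow> realizes s E U \<Longrightarrow> realizes t E V \<Longrightarrow> realizes (Node b s t) E (U \<union> V)"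
  by (auto simp: realizes.simps(2))

lemma realizes_commute: "realizes (Node b s t) E W \<Longrightarrow> realizes (Node b t s) E W"
proof (erule realizes_NodeE)
  fix U V
  assume "W = U \<union> V" "cross E b U V" "realizes s E U" "realizes t E V"
  then show "realizes (Node b t s) E W"
    using realizes_NodeI[of E b V U t s] by (simp add: cross_commute[of E b U] Un_commute)
qed

lemma realizes_assoc:
  assumes "realizes (Node b (Node b r s) t) E W"
  shows "realizes (Node b r (Node b s t)) E W"
proof -
  obtain A B C where *: "realizes r E A" "realizes s E B" "realizes t E C"
    "W = A \<union> B \<union> C" "cross E b A B" "cross E b (A \<union> B) C"
    using assms by (auto elim!: realizes_NodeE)
  then have "cross E b A (B \<union> C)" "cross E b B C"
    by (auto simp: cross_Un_left cross_Un_right)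
  then have "realizes (Node b r (Node b s t)) E (A \<union> (B \<union> C))"
    using * by (intro realizes_NodeI)
  then show ?thesis using *(4) by (simp add: Un_assoc)
qed

lemma realizes_left_commute:
  assumes "realizes (Node b r (Node b s t)) E W"
  shows "realizes (Node b s (Node b r t)) E W"
proof -
  obtain A B C where *: "realizes r E A" "realizes s E B" "realizes t E C"
    "W = A \<union> (B \<union> C)" "cross E b B C" "cross E b A (B \<union> C)"
    using assms by (auto elim!: realizes_NodeE)
  then have "W = B \<union> (A \<union> C)" "cross E b A C" "cross E b B (A \<union> C)"
    by (auto simp: cross_Un_right cross_commute[of E b B A])
  then show ?thesis using *(1-3) by (simp add: realizes_NodeI)
qed

lemma realizes_Node_mono:
  assumes "realizes (Node b s t) E W"
    and "\<And>U. realizes s E U \<Longrightarrow> realizes s' E U" "\<And>U. realizes t E U \<Longrightarrow> realizes t' E U"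
  shows "realizes (Node b s' t') E W"
  using assms(1) by (rule realizes_NodeE) (simp add: assms(2,3) realizes_NodeI)

section \<open>Normal forms of binary cotrees\<close>

primrec leaves :: "cotree \<Rightarrow> nat" where
  "leaves Leaf = 1"
| "leaves (Node b s t) = leaves s + leaves t"

text \<open>A run of nodes labelled \<open>b\<close> is read as a right-nested list of children,
  whose last entry is a leaf or a node with the other label. This is insertion into that list,
  ordered by number of leaves.\<close>

fun insert_child :: "bool \<Rightarrow> cotree \<Rightarrow> cotree \<Rightarrow> cotree" where
  "insert_child b x Leaf = (if leaves x \<le> 1 then Node b x Leaf else Node b Leaf x)"
| "insert_child b x (Node c y r) =
     (if c = b then if leaves x \<le> leaves y then Node b x (Node c y r) else Node b y (insert_child b x r)
      else if leaves x \<le> leaves (Node c y r) then Node b x (Node c y r) else Node b (Node c y r) x)"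

text \<open>Sorting the children by their number of leaves only gives a normal form up to ties.
  For the finitely many trees that occur below there are no harmful ties.\<close>

fun merge_children :: "bool \<Rightarrow> cotree \<Rightarrow> cotree \<Rightarrow> cotree" where
  "merge_children b Leaf t = insert_child b Leaf t"
| "merge_children b (Node c y r) t =
     (if c = b then insert_child b y (merge_children b r t) else insert_child b (Node c y r) t)"

fun cotree_nf :: "cotree \<Rightarrow> cotree" where
  "cotree_nf Leaf = Leaf"
| "cotree_nf (Node b s t) = merge_children b (cotree_nf s) (cotree_nf t)"

text \<open>Insertion only swaps operands or exchanges neighbouring children of one label, and both
  keep the realized graph.\<close>

lemma realizes_insert_child: "realizes (Node b x t) E W \<Longrightarrow> realizes (insert_child b x t) E W"
proof (induction b x t arbitrary: W rule: insert_child.induct)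
  case (1 b x)
  then show ?case using realizes_commute[of b x Leaf E W] by (cases "leaves x \<le> 1") simp_all
next
  case (2 b x c y r)
  show ?case
  proof (cases "c = b \<and> \<not> leaves x \<le> leaves y")
    case True
    then have "realizes (Node b y (Node b x r)) E W"
      using 2(2) realizes_left_commute by blast
    then have "realizes (Node b y (insert_child b x r)) E W"
      by (rule realizes_Node_mono) (use 2(1) True in auto)
    with True show ?thesis by simp
  next
    case False
    then show ?thesis
      using 2(2) realizes_commute[OF 2(2)] by auto
  qed
qed

lemma realizes_merge_children:
  "realizes (Node b s t) E W \<Longrightarrow> realizes (merge_children b s t) E W"
proof (induction b s t arbitrary: W rule: merge_children.induct)
  case (1 b t)
  then show ?case using realizes_insert_child by (simp only: merge_children.simps)
next
  case (2 b c y r t)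
  show ?case
  proof (cases "c = b")
    case True
    then have "realizes (Node b y (Node b r t)) E W"
      using 2(2) realizes_assoc by blast
    then have "realizes (Node b y (merge_children b r t)) E W"
      by (rule realizes_Node_mono) (use 2(1) True in auto)
    with True show ?thesis using realizes_insert_child by simp
  next
    case False
    then show ?thesis using 2(2) realizes_insert_child by simp
  qed
qed

lemma realizes_cotree_nf: "realizes t E W \<Longrightarrow> realizes (cotree_nf t) E W"
proof (induction t arbitrary: W)
  case (Node b s t)
  have "realizes (Node b (cotree_nf s) (cotree_nf t)) E W"
    using Node.prems by (rule realizes_Node_mono) (use Node.IH in auto)
  then show ?case by (simp add: realizes_merge_children)
qed simp

section \<open>Cographs have cotrees\<close>

text \<open>An induced path written out on four vertices; the non-edges are given in one direction
  only, as \<open>E\<close> is symmetric wherever this is linked to graphs.\<close>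

definition P4_free :: "'a rel \<Rightarrow> 'a set \<Rightarrow> bool" where
  "P4_free E W \<longleftrightarrow> \<not> (\<exists>a\<in>W. \<exists>b\<in>W. \<exists>c\<in>W. \<exists>d\<in>W. distinct [a, b, c, d] \<and>
     (a, b) \<in> E \<and> (b, c) \<in> E \<and> (c, d) \<in> E \<and> (a, c) \<notin> E \<and> (a, d) \<notin> E \<and> (b, d) \<notin> E)"

lemma P4_freeD:
  assumes "P4_free E W" "a \<in> W" "b \<in> W" "c \<in> W" "d \<in> W" "distinct [a, b, c, d]"
    "(a, b) \<in> E" "(b, c) \<in> E" "(c, d) \<in> E" "(a, c) \<notin> E" "(a, d) \<notin> E" "(b, d) \<notin> E"
  shows False
  using assms(1) unfolding P4_free_def
  by (rule notE) (intro bexI[of _ a] bexI[of _ b] bexI[of _ c] bexI[of _ d] conjI; fact assms)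

lemma P4_free_mono: "P4_free E W \<Longrightarrow> U \<subseteq> W \<Longrightarrow> P4_free E U"
  unfolding P4_free_def by blast

text \<open>P4 is self-complementary: the path \<open>a b c d\<close> turns into
  \<open>b d a c\<close>. The raw complement \<open>- E\<close> may contain the diagonal, which is
  harmless because the four vertices are distinct.\<close>

lemma P4_free_Compl:
  assumes "sym E" "P4_free E W"
  shows "P4_free (- E) W"
  unfolding P4_free_def
proof (intro notI, elim bexE conjE)
  fix a b c d
  assume *: "a \<in> W" "b \<in> W" "c \<in> W" "d \<in> W" "distinct [a, b, c, d]" "(a, b) \<in> - E" "(b, c) \<in> - E"
    "(c, d) \<in> - E" "(a, c) \<notin> - E" "(a, d) \<notin> - E" "(b, d) \<notin> - E"
  then have "(b, d) \<in> E" "(d, a) \<in> E" "(a, c) \<in> E" "(b, a) \<notin> E" "(b, c) \<notin> E" "(d, c) \<notin> E"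
    using assms(1) by (auto dest: symD)
  moreover have "distinct [b, d, a, c]"
    using * by auto
  ultimately show False
    using P4_freeD[OF assms(2), of b d a c] * by blast
qed

lemma cross_Compl: "cross (- E) b U V \<longleftrightarrow> cross E (\<not> b) U V"
  by (auto simp: cross_def)

text \<open>If \<open>x\<close> has a neighbour in the component \<open>C\<close> of one of its non-neighbours \<open>y\<close>, then some edge
  of \<open>C\<close> has exactly one end adjacent to \<open>x\<close>, and a neighbour of \<open>x\<close> outside \<open>C\<close>
  would complete a \<open>P\<^sub>4\<close>.\<close>

lemma cross_extend:
  assumes "sym E" "P4_free E (insert x W)" "x \<notin> W"
    and split: "cross E False U V" "W = U \<union> V" "U \<noteq> {}" "V \<noteq> {}"
  shows "\<exists>b U' V'. cross E b U' V' \<and> insert x W = U' \<union> V' \<and> U' \<noteq> {} \<and> V' \<noteq> {}"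
proof (cases "\<forall>y\<in>W. (x, y) \<in> E")
  case True
  then have "cross E True {x} W"
    using assms(1,3) by (auto simp: cross_def dest: symD)
  then show ?thesis using split by blast
next
  case False
  then obtain y where y: "y \<in> W" "(x, y) \<notin> E" by blast
  let ?R = "E \<inter> W \<times> W"
  define C where "C = {v \<in> W. (y, v) \<in> ?R\<^sup>*}"
  have C_closed: "v \<in> C" if "u \<in> C" "(u, v) \<in> E" "v \<in> W" for u v
  proof -
    have "(u, v) \<in> ?R" "(y, u) \<in> ?R\<^sup>*" using that by (auto simp: C_def)
    then have "(y, v) \<in> ?R\<^sup>*" by (rule rtrancl_into_rtrancl[rotated])
    then show ?thesis using that(3) by (simp add: C_def)
  qed
  have no_edge: "(u, v) \<notin> E" "(v, u) \<notin> E" if "u \<in> C" "v \<in> W - C" for u v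
    using that C_closed symD[OF assms(1)] by blast+
  \<comment> \<open>A walk cannot cross the split, so the side that misses \<open>C\<close> shows
    \<open>W - C\<close> to be nonempty; this keeps the new right part below from being
    empty.\<close>
  have "C \<subseteq> U \<or> C \<subseteq> V"
  proof -
    have "(v \<in> U) = (y \<in> U)" if "(y, v) \<in> ?R\<^sup>*" for v
      using that
    proof (induction rule: rtrancl_induct)
      case (step u v)
      then show ?case using split by (auto simp: cross_def)
    qed simp
    then show ?thesis using split by (auto simp: C_def)
  qed
  then have "W - C \<noteq> {}" using split by (auto simp: cross_def)
  have "C \<noteq> {}" using y by (auto simp: C_def)
  show ?thesis
  proof (cases "\<exists>z\<in>C. (x, z) \<in> E")
    case False
    then have "cross E False C (insert x (W - C))"
      using no_edge assms(3) symD[OF assms(1)] by (auto simp: cross_def C_def)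
    moreover have "insert x W = C \<union> insert x (W - C)" by (auto simp: C_def)
    ultimately show ?thesis using \<open>C \<noteq> {}\<close> by blast
  next
    case True
    then obtain z where z: "z \<in> C" "(x, z) \<in> E" by blast
    \<comment> \<open>Otherwise non-adjacency to \<open>x\<close> would spread along walks from
      \<open>y\<close> to all of \<open>C\<close>, including \<open>z\<close>.\<close>
    have "\<exists>p q. p \<in> C \<and> q \<in> C \<and> (p, q) \<in> E \<and> (x, p) \<notin> E \<and> (x, q) \<in> E"
    proof (rule ccontr)
      assume contra: "\<not> ?thesis"
      have "v \<in> C \<and> (x, v) \<notin> E" if "(y, v) \<in> ?R\<^sup>*" for v
        using that
      proof (induction rule: rtrancl_induct)
        case base
        then show ?case using y by (auto simp: C_def)
      next
        case (step u v)
        then show ?case using contra C_closed by blast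
      qed
      then show False using z by (auto simp: C_def)
    qed
    then obtain p q where pq: "p \<in> C" "q \<in> C" "(p, q) \<in> E" "(x, p) \<notin> E" "(x, q) \<in> E" by blast
    have "(x, w) \<notin> E" if w: "w \<in> W - C" for w
    proof
      assume xw: "(x, w) \<in> E"
      have "distinct [p, q, x, w]" "p \<in> W" "q \<in> W" "w \<in> W"
        using pq w assms(3) by (auto simp: C_def)
      moreover have "(q, x) \<in> E" "(p, x) \<notin> E" "(p, w) \<notin> E" "(q, w) \<notin> E"
        using pq no_edge w symD[OF assms(1)] by blast+
      ultimately show False
        using P4_freeD[OF assms(2), of p q x w] pq xw by blast
    qed
    moreover from this have "(w, x) \<notin> E" if "w \<in> W - C" for w
      using that symD[OF assms(1)] by blast
    ultimately have "cross E False (insert x C) (W - C)"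
      using no_edge assms(3) by (auto simp: cross_def)
    moreover have "insert x W = insert x C \<union> (W - C)" by (auto simp: C_def)
    ultimately show ?thesis using \<open>W - C \<noteq> {}\<close> by blast
  qed
qed

text \<open>The classical fact that a P4-free graph with at least two vertices is disconnected or
  has a disconnected complement. Vertices are added one at a time; if the smaller set is a join,
  \<open>cross_extend\<close> is applied to \<open>- E\<close>, where it is a union.\<close>

lemma P4_free_cross:
  assumes "finite W" "card W \<ge> 2" "sym E" "P4_free E W"
  shows "\<exists>b U V. cross E b U V \<and> W = U \<union> V \<and> U \<noteq> {} \<and> V \<noteq> {}"
  using assms(1,2,4)
proof (induction W rule: finite_induct)
  case empty
  then show ?case by simp
next
  case (insert x W)
  show ?case
  proof (cases "card W \<ge> 2")
    case True
    then obtain b U V where *: "cross E b U V" "W = U \<union> V" "U \<noteq> {}" "V \<noteq> {}"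
      using insert P4_free_mono[of E "insert x W" W] by blast
    show ?thesis
    proof (cases b)
      case False
      then show ?thesis
        using cross_extend[OF assms(3) insert.prems(2) insert.hyps(2)] * by simp
    next
      case True
      have "sym (- E)" using assms(3) by (auto simp: sym_def)
      then show ?thesis
        using cross_extend[of "- E" x W U V] P4_free_Compl[OF assms(3) insert.prems(2)]
          insert.hyps(2) * True unfolding cross_Compl by auto
    qed
  next
    case False
    then have "card W = 1" using insert by simp
    then obtain y where y: "W = {y}" by (rule card_1_singletonE)
    then have "x \<noteq> y" using insert by auto
    then have "cross E ((x, y) \<in> E) {x} {y}"
      using assms(3) by (auto simp: cross_def dest: symD)
    then show ?thesis using y by blast
  qed
qed

text \<open>P4 and its complement are both connected. A pair whose adjacency disagrees with the
  label \<open>c\<close> lies on one side, so either the three edges or the three non-edges force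
  all four vertices into the same operand.\<close>

lemma realizes_P4_free:
  "realizes t E W \<Longrightarrow> P4_free E W"
proof (induction t arbitrary: W)
  case Leaf
  then show ?case by (auto simp: P4_free_def)
next
  case (Node c s t)
  then obtain U V where UV: "W = U \<union> V" "cross E c U V" "P4_free E U" "P4_free E V"
    by (auto elim: realizes_NodeE)
  show ?case
    unfolding P4_free_def
  proof (intro notI, elim bexE conjE)
    fix p q r s
    assume *: "p \<in> W" "q \<in> W" "r \<in> W" "s \<in> W" "distinct [p, q, r, s]"
      "(p, q) \<in> E" "(q, r) \<in> E" "(r, s) \<in> E" "(p, r) \<notin> E" "(p, s) \<notin> E" "(q, s) \<notin> E"
    have same: "(p \<in> U \<and> q \<in> U \<and> r \<in> U \<and> s \<in> U) \<or> (p \<in> V \<and> q \<in> V \<and> r \<in> V \<and> s \<in> V)"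
    proof -
      have side: "x \<in> U \<longleftrightarrow> y \<in> U" if "x \<in> W" "y \<in> W" "((x, y) \<in> E) \<noteq> c" for x y
        using that UV(1,2) unfolding cross_def by blast
      have "(p \<in> U \<longleftrightarrow> q \<in> U) \<and> (q \<in> U \<longleftrightarrow> r \<in> U) \<and> (r \<in> U \<longleftrightarrow> s \<in> U)"
      proof (cases c)
        case True
        then show ?thesis using side[of p r] side[of p s] side[of q s] * by simp
      next
        case False
        then show ?thesis using side[of p q] side[of q r] side[of r s] * by simp
      qed
      then show ?thesis using * UV(1) by blast
    qed
    have False if "P4_free E X" "p \<in> X" "q \<in> X" "r \<in> X" "s \<in> X" for X
      using P4_freeD[OF that *(5-)] .
    then show False
      using same UV(3,4) by blast
  qed
qed

section \<open>States of a vertex set\<close>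

datatype side = Void | Indep | Multi

text \<open>Complete multipartite without mentioning a partition: for symmetric irreflexive
  \<open>E\<close>, the parts are the classes of non-adjacency.\<close>

definition nonadj_trans :: "'a rel \<Rightarrow> 'a set \<Rightarrow> bool" where
  "nonadj_trans E A \<longleftrightarrow>
     (\<forall>u\<in>A. \<forall>v\<in>A. \<forall>w\<in>A. (u, v) \<notin> E \<longrightarrow> (v, w) \<notin> E \<longrightarrow> (u, w) \<notin> E)"

definition P3_free :: "'a rel \<Rightarrow> 'a set \<Rightarrow> bool" where
  "P3_free E B \<longleftrightarrow>
     (\<forall>u\<in>B. \<forall>v\<in>B. \<forall>w\<in>B. (u, v) \<in> E \<longrightarrow> (v, w) \<in> E \<longrightarrow> u \<noteq> w \<longrightarrow> (u, w) \<in> E)"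

lemma nonadj_transD:
  "nonadj_trans E A \<Longrightarrow> (u, v) \<notin> E \<Longrightarrow> (v, w) \<notin> E \<Longrightarrow> u \<in> A \<Longrightarrow> v \<in> A \<Longrightarrow> w \<in> A \<Longrightarrow> (u, w) \<notin> E"
  unfolding nonadj_trans_def by blast

lemma P3_freeD:
  "P3_free E B \<Longrightarrow> (u, v) \<in> E \<Longrightarrow> (v, w) \<in> E \<Longrightarrow> u \<noteq> w \<Longrightarrow> u \<in> B \<Longrightarrow> v \<in> B \<Longrightarrow> w \<in> B \<Longrightarrow> (u, w) \<in> E"
  unfolding P3_free_def by blast

lemma nonadj_trans_mono: "nonadj_trans E A \<Longrightarrow> A' \<subseteq> A \<Longrightarrow> nonadj_trans E A'"
  unfolding nonadj_trans_def by blast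

lemma P3_free_mono: "P3_free E B \<Longrightarrow> B' \<subseteq> B \<Longrightarrow> P3_free E B'"
  unfolding P3_free_def by blast

primrec side_ok :: "side \<Rightarrow> 'a rel \<Rightarrow> 'a set \<Rightarrow> bool" where
  "side_ok Void E A \<longleftrightarrow> A = {}"
| "side_ok Indep E A \<longleftrightarrow> (\<forall>u\<in>A. \<forall>v\<in>A. (u, v) \<notin> E)"
| "side_ok Multi E A \<longleftrightarrow> nonadj_trans E A"

text \<open>Closed neighbourhoods. In a P3-free set they are the components, so cliques can be
  counted without reachability.\<close>

definition clique_class :: "'a rel \<Rightarrow> 'a set \<Rightarrow> 'a \<Rightarrow> 'a set" where
  "clique_class E B v = {u \<in> B. u = v \<or> (v, u) \<in> E}"

definition clusters :: "'a rel \<Rightarrow> 'a set \<Rightarrow> nat \<Rightarrow> bool" where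
  "clusters E B k \<longleftrightarrow> P3_free E B \<and> card (clique_class E B ` B) \<le> k"

definition splits :: "side \<Rightarrow> 'a rel \<Rightarrow> 'a set \<Rightarrow> nat \<Rightarrow> bool" where
  "splits m E W k \<longleftrightarrow> (\<exists>A\<subseteq>W. side_ok m E A \<and> clusters E (W - A) k)"

lemma side_ok_mono: "side_ok m E A \<Longrightarrow> A' \<subseteq> A \<Longrightarrow> side_ok m E A'"
  by (cases m) (auto intro: nonadj_trans_mono)

text \<open>If both sides are met, a vertex \<open>y\<close> of the far side is a common
  non-neighbour of any \<open>u\<close> and \<open>v\<close> on the near side, and transitivity
  through \<open>y\<close> makes these non-adjacent. Conversely two independent sides together form
  a single part.\<close>

lemma side_ok_Un_no_edges:
  assumes "cross E False A A'"
  shows "side_ok Indep E (A \<union> A') \<longleftrightarrow> side_ok Indep E A \<and> side_ok Indep E A'"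
    and "side_ok Multi E (A \<union> A') \<longleftrightarrow>
      side_ok Void E A \<and> side_ok Multi E A' \<or> side_ok Multi E A \<and> side_ok Void E A' \<or>
      side_ok Indep E A \<and> side_ok Indep E A'"
proof -
  show "side_ok Indep E (A \<union> A') \<longleftrightarrow> side_ok Indep E A \<and> side_ok Indep E A'"
    using assms unfolding cross_def by auto
  have indep: "side_ok Indep E X" if "side_ok Multi E (X \<union> Y)" "cross E False X Y" "y \<in> Y" for X Y y
    unfolding side_ok.simps
  proof (intro ballI)
    fix u v
    assume "u \<in> X" "v \<in> X"
    then have "(u, y) \<notin> E" "(y, v) \<notin> E" using that(2,3) by (auto simp: cross_def)
    then show "(u, v) \<notin> E" using that(1,3) \<open>u \<in> X\<close> \<open>v \<in> X\<close> using nonadj_transD[of E "X \<union> Y" u y v] by simp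
  qed
  have multi: "side_ok Multi E (A \<union> A')" if "side_ok Indep E A" "side_ok Indep E A'"
    using that assms unfolding cross_def side_ok.simps nonadj_trans_def by blast
  show "side_ok Multi E (A \<union> A') \<longleftrightarrow>
      side_ok Void E A \<and> side_ok Multi E A' \<or> side_ok Multi E A \<and> side_ok Void E A' \<or>
      side_ok Indep E A \<and> side_ok Indep E A'"
  proof (cases "A = {} \<or> A' = {}")
    case True
    then show ?thesis by (auto simp: nonadj_trans_def)
  next
    case False
    then obtain y y' where "y \<in> A" "y' \<in> A'" by blast
    then show ?thesis
      using False indep[of A A' y'] indep[of A' A y] multi assms cross_commute[of E False A A']
      by (auto simp only: Un_commute[of A' A] side_ok.simps(1))
  qed
qed

text \<open>Non-adjacent vertices lie on one side of a join, so the parts of the two sides are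
  simply collected and no part meets both.\<close>

lemma side_ok_Un_all_edges:
  assumes "cross E True A A'"
  shows "side_ok Indep E (A \<union> A') \<longleftrightarrow>
      side_ok Void E A \<and> side_ok Indep E A' \<or> side_ok Indep E A \<and> side_ok Void E A'"
    and "side_ok Multi E (A \<union> A') \<longleftrightarrow> side_ok Multi E A \<and> side_ok Multi E A'"
proof -
  show "side_ok Indep E (A \<union> A') \<longleftrightarrow>
      side_ok Void E A \<and> side_ok Indep E A' \<or> side_ok Indep E A \<and> side_ok Void E A'"
    using assms unfolding cross_def by auto
  have "side_ok Multi E (A \<union> A')" if "side_ok Multi E A" "side_ok Multi E A'"
    unfolding side_ok.simps nonadj_trans_def
  proof (intro ballI impI)
    fix u v w
    assume *: "u \<in> A \<union> A'" "v \<in> A \<union> A'" "w \<in> A \<union> A'" "(u, v) \<notin> E" "(v, w) \<notin> E"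
    have "(x, y) \<in> E" "(y, x) \<in> E" if "x \<in> A" "y \<in> A'" for x y
      using assms that by (auto simp: cross_def)
    with * have "(u \<in> A \<and> v \<in> A \<and> w \<in> A) \<or> (u \<in> A' \<and> v \<in> A' \<and> w \<in> A')"
      by blast
    then show "(u, w) \<notin> E"
      using that[unfolded side_ok.simps, THEN nonadj_transD, of u v w] *(4,5) by blast
  qed
  then show "side_ok Multi E (A \<union> A') \<longleftrightarrow> side_ok Multi E A \<and> side_ok Multi E A'"
    using side_ok_mono[of Multi E "A \<union> A'"] by blast
qed

section \<open>Clusters with a bounded number of cliques, under union and join\<close>

lemma clusters_0: "finite B \<Longrightarrow> clusters E B 0 \<longleftrightarrow> B = {}"
  by (auto simp: clusters_def P3_free_def)

lemma clusters_le: "clusters E B k \<Longrightarrow> k \<le> l \<Longrightarrow> clusters E B l"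
  by (auto simp: clusters_def)

lemma clusters_1:
  assumes "finite B"
  shows "clusters E B 1 \<longleftrightarrow> (\<forall>u\<in>B. \<forall>v\<in>B. u \<noteq> v \<longrightarrow> (u, v) \<in> E)"
proof
  assume *: "clusters E B 1"
  show "\<forall>u\<in>B. \<forall>v\<in>B. u \<noteq> v \<longrightarrow> (u, v) \<in> E"
  proof (intro ballI impI)
    fix u v
    assume uv: "u \<in> B" "v \<in> B" "u \<noteq> v"
    have "card (clique_class E B ` B) \<le> Suc 0" using * by (simp add: clusters_def)
    moreover have "finite (clique_class E B ` B)" using assms by simp
    ultimately have "\<forall>X\<in>clique_class E B ` B. \<forall>Y\<in>clique_class E B ` B. X = Y"
      by (simp only: card_le_Suc0_iff_eq)
    then have "clique_class E B u = clique_class E B v"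
      using uv(1,2) by blast
    then show "(u, v) \<in> E" using uv by (auto simp: clique_class_def)
  qed
next
  assume *: "\<forall>u\<in>B. \<forall>v\<in>B. u \<noteq> v \<longrightarrow> (u, v) \<in> E"
  have "clique_class E B ` B \<subseteq> {B}" using * by (auto simp: clique_class_def)
  then have "card (clique_class E B ` B) \<le> 1" using card_mono[of "{B}"] by simp
  moreover have "P3_free E B" using * by (simp add: P3_free_def)
  ultimately show "clusters E B 1" by (simp add: clusters_def)
qed

lemma clusters_mono:
  assumes "clusters E B k" "B' \<subseteq> B" "finite B"
  shows "clusters E B' k"
proof -
  \<comment> \<open>Each class of the subset is the trace of a class of \<open>B\<close>, so their
    number cannot grow.\<close>
  have "clique_class E B' ` B' = (\<lambda>X. X \<inter> B') ` (clique_class E B ` B')"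
    unfolding image_image using assms(2) by (intro image_cong) (auto simp: clique_class_def)
  then have "card (clique_class E B' ` B') \<le> card (clique_class E B ` B')"
    using assms(2,3) by (metis card_image_le finite_imageI rev_finite_subset)
  also have "\<dots> \<le> card (clique_class E B ` B)"
    using assms by (intro card_mono) auto
  finally show ?thesis
    using assms(1,2) P3_free_mono by (auto simp: clusters_def)
qed

lemma clusters_Un_no_edges:
  assumes "cross E False B B'" "finite B" "finite B'"
  shows "clusters E (B \<union> B') k \<longleftrightarrow> (\<exists>i\<le>k. clusters E B i \<and> clusters E B' (k - i))"
proof -
  have cls: "clique_class E (B \<union> B') v = clique_class E B v" if "v \<in> B" for v
    using assms(1) that by (auto simp: cross_def clique_class_def)
  have cls': "clique_class E (B \<union> B') v = clique_class E B' v" if "v \<in> B'" for v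
    using assms(1) that by (auto simp: cross_def clique_class_def)
  have "clique_class E (B \<union> B') ` (B \<union> B') = clique_class E B ` B \<union> clique_class E B' ` B'"
    unfolding image_Un by (rule arg_cong2[of _ _ _ _ "(\<union>)"]; rule image_cong) (simp_all add: cls cls')
  moreover have "clique_class E B ` B \<inter> clique_class E B' ` B' = {}"
  proof -
    have "v \<in> clique_class E B v" "clique_class E B v \<subseteq> B" if "v \<in> B" for v B
      using that by (auto simp: clique_class_def)
    then show ?thesis using assms(1) unfolding cross_def by blast
  qed
  ultimately have card: "card (clique_class E (B \<union> B') ` (B \<union> B')) =
      card (clique_class E B ` B) + card (clique_class E B' ` B')"
    using assms by (simp add: card_Un_disjoint)
  have "P3_free E (B \<union> B')" if free: "P3_free E B" "P3_free E B'"
    unfolding P3_free_def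
  proof (intro ballI impI)
    fix u v w
    assume *: "u \<in> B \<union> B'" "v \<in> B \<union> B'" "w \<in> B \<union> B'" "(u, v) \<in> E" "(v, w) \<in> E" "u \<noteq> w"
    have "(x, y) \<notin> E" "(y, x) \<notin> E" if "x \<in> B" "y \<in> B'" for x y
      using assms that by (auto simp: cross_def)
    with * have "(u \<in> B \<and> v \<in> B \<and> w \<in> B) \<or> (u \<in> B' \<and> v \<in> B' \<and> w \<in> B')"
      by blast
    then show "(u, w) \<in> E"
      using free[THEN P3_freeD, of u v w] *(4-6) by blast
  qed
  then have trans: "P3_free E (B \<union> B') \<longleftrightarrow> P3_free E B \<and> P3_free E B'"
    using P3_free_mono[of E "B \<union> B'"] by blast
  \<comment> \<open>The class counts add up; the witness \<open>i = x\<close> gives the first side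
    exactly what it uses and the rest of \<open>k\<close> to the second.\<close>
  have "x + y \<le> k \<longleftrightarrow> (\<exists>i\<le>k. x \<le> i \<and> y \<le> k - i)" for x y :: nat
    by (auto intro: exI[of _ x])
  then show ?thesis
    unfolding clusters_def trans card by blast
qed

text \<open>If both sides are nonempty, two vertices of one side have a common neighbour across, so
  a P3-free join is one clique. The alternatives with bound 0 stand for an empty side.\<close>

lemma clusters_Un_all_edges:
  assumes "cross E True B B'" "finite B" "finite B'"
  shows "clusters E (B \<union> B') k \<longleftrightarrow>
    clusters E B 0 \<and> clusters E B' k \<or> clusters E B k \<and> clusters E B' 0 \<or>
    1 \<le> k \<and> clusters E B 1 \<and> clusters E B' 1"
proof (cases "B = {} \<or> B' = {}")
  case True
  moreover have "clusters E {} k" for k by (simp add: clusters_def P3_free_def)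
  ultimately show ?thesis using assms clusters_le[of E _ 1 k] by (auto simp: clusters_0)
next
  case False
  then obtain x y where xy: "x \<in> B" "y \<in> B'" by auto
  have "1 \<le> k \<and> clusters E (B \<union> B') 1" if "clusters E (B \<union> B') k"
  proof -
    have *: "(u, w) \<in> E" if "u \<in> B \<union> B'" "v \<in> B \<union> B'" "w \<in> B \<union> B'" "(u, v) \<in> E" "(v, w) \<in> E" "u \<noteq> w" for u v w
      using P3_freeD[of E "B \<union> B'" u v w] \<open>clusters E (B \<union> B') k\<close> that by (simp add: clusters_def)
    have "(u, v) \<in> E" if "u \<in> B \<union> B'" "v \<in> B \<union> B'" "u \<noteq> v" for u v
    proof -
      have "(a, b) \<in> E" "(b, a) \<in> E" if "a \<in> B" "b \<in> B'" for a b
        using assms(1) that by (auto simp: cross_def)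
      then show ?thesis
        using that *[of u x v] *[of u y v] xy by blast
    qed
    then have "clusters E (B \<union> B') 1"
      unfolding clusters_1[OF finite_UnI[OF assms(2,3)]] by blast
    moreover have "1 \<le> k" using that False clusters_0[of "B \<union> B'" E] assms by (cases k) auto
    ultimately show ?thesis by simp
  qed
  moreover have "clusters E (B \<union> B') 1 \<longleftrightarrow> clusters E B 1 \<and> clusters E B' 1"
  proof -
    have "(a, b) \<in> E" "(b, a) \<in> E" if "a \<in> B" "b \<in> B'" for a b
      using assms(1) that by (auto simp: cross_def)
    then show ?thesis
      unfolding clusters_1[OF assms(2)] clusters_1[OF assms(3)]
        clusters_1[OF finite_UnI[OF assms(2,3)]] by blast
  qed
  moreover have "\<not> clusters E B 0" "\<not> clusters E B' 0"
    using False assms by (simp_all add: clusters_0)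
  ultimately show ?thesis
    using clusters_le[of E "B \<union> B'" 1 k] by blast
qed

lemma splits_Un:
  assumes "U \<inter> V = {}"
  shows "splits m E (U \<union> V) k \<longleftrightarrow>
    (\<exists>A A'. A \<subseteq> U \<and> A' \<subseteq> V \<and> side_ok m E (A \<union> A') \<and> clusters E ((U - A) \<union> (V - A')) k)"
proof
  assume "splits m E (U \<union> V) k"
  then obtain A where A: "A \<subseteq> U \<union> V" "side_ok m E A" "clusters E (U \<union> V - A) k"
    by (auto simp: splits_def)
  have "A \<inter> U \<union> A \<inter> V = A" "(U - A \<inter> U) \<union> (V - A \<inter> V) = U \<union> V - A" using A(1) by auto
  then show "\<exists>A A'. A \<subseteq> U \<and> A' \<subseteq> V \<and> side_ok m E (A \<union> A') \<and> clusters E ((U - A) \<union> (V - A')) k"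
    using A by (intro exI[of _ "A \<inter> U"] exI[of _ "A \<inter> V"]) auto
next
  assume "\<exists>A A'. A \<subseteq> U \<and> A' \<subseteq> V \<and> side_ok m E (A \<union> A') \<and> clusters E ((U - A) \<union> (V - A')) k"
  then obtain A A' where A: "A \<subseteq> U" "A' \<subseteq> V" "side_ok m E (A \<union> A')" "clusters E ((U - A) \<union> (V - A')) k"
    by blast
  then have "(U - A) \<union> (V - A') = U \<union> V - (A \<union> A')" using assms by auto
  then show "splits m E (U \<union> V) k"
    using A unfolding splits_def by (intro exI[of _ "A \<union> A'"]) auto
qed

text \<open>\<open>par_splits\<close> and \<open>ser_splits\<close> detach the two cluster rules
  from vertex sets: they act on arbitrary predicates of the number of cliques, which is all that
  levels depend on.\<close>

definition par_splits :: "(nat \<Rightarrow> bool) \<Rightarrow> (nat \<Rightarrow> bool) \<Rightarrow> nat \<Rightarrow> bool" where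
  "par_splits P Q k \<longleftrightarrow> (\<exists>i\<le>k. P i \<and> Q (k - i))"

definition ser_splits :: "(nat \<Rightarrow> bool) \<Rightarrow> (nat \<Rightarrow> bool) \<Rightarrow> nat \<Rightarrow> bool" where
  "ser_splits P Q k \<longleftrightarrow> P 0 \<and> Q k \<or> P k \<and> Q 0 \<or> 1 \<le> k \<and> P 1 \<and> Q 1"

text \<open>The shapes \<open>m\<close> and \<open>m'\<close> on the two sides may differ, since a
  multipartite set in a union also splits as \<open>Void\<close> with \<open>Multi\<close>.\<close>

lemma par_splits_clusters:
  assumes "cross E False U V" "finite U" "finite V"
  shows "(\<exists>A A'. A \<subseteq> U \<and> A' \<subseteq> V \<and> (side_ok m E A \<and> side_ok m' E A') \<and>
      clusters E ((U - A) \<union> (V - A')) k) \<longleftrightarrow>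
    par_splits (splits m E U) (splits m' E V) k"
proof -
  have "clusters E ((U - A) \<union> (V - A')) k \<longleftrightarrow> (\<exists>i\<le>k. clusters E (U - A) i \<and> clusters E (V - A') (k - i))"
    for A A'
    using assms cross_mono[OF assms(1), of "U - A" "V - A'"] by (intro clusters_Un_no_edges) auto
  then show ?thesis unfolding par_splits_def splits_def by blast
qed

lemma ser_splits_clusters:
  assumes "cross E True U V" "finite U" "finite V"
  shows "(\<exists>A A'. A \<subseteq> U \<and> A' \<subseteq> V \<and> (side_ok m E A \<and> side_ok m' E A') \<and>
      clusters E ((U - A) \<union> (V - A')) k) \<longleftrightarrow>
    ser_splits (splits m E U) (splits m' E V) k"
proof -
  have "clusters E ((U - A) \<union> (V - A')) k \<longleftrightarrow>
      clusters E (U - A) 0 \<and> clusters E (V - A') k \<or> clusters E (U - A) k \<and> clusters E (V - A') 0 \<or>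
      1 \<le> k \<and> clusters E (U - A) 1 \<and> clusters E (V - A') 1" for A A'
    using assms cross_mono[OF assms(1), of "U - A" "V - A'"] by (intro clusters_Un_all_edges) auto
  then show ?thesis unfolding ser_splits_def splits_def by blast
qed

lemma side_ok_Void_Un: "side_ok Void E (A \<union> A') \<longleftrightarrow> side_ok Void E A \<and> side_ok Void E A'"
  by auto

lemma splits_par:
  assumes "cross E False U V" "finite U" "finite V"
  shows "splits Void E (U \<union> V) k \<longleftrightarrow> par_splits (splits Void E U) (splits Void E V) k"
    and "splits Indep E (U \<union> V) k \<longleftrightarrow> par_splits (splits Indep E U) (splits Indep E V) k"
    and "splits Multi E (U \<union> V) k \<longleftrightarrow>
      par_splits (splits Void E U) (splits Multi E V) k \<or>
      par_splits (splits Multi E U) (splits Void E V) k \<or>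
      par_splits (splits Indep E U) (splits Indep E V) k"
proof -
  have UV: "U \<inter> V = {}" using assms(1) by (simp add: cross_def)
  note ok = side_ok_Un_no_edges[OF cross_mono[OF assms(1)]]
  note iffs = par_splits_clusters[OF assms, symmetric]
  show "splits Void E (U \<union> V) k \<longleftrightarrow> par_splits (splits Void E U) (splits Void E V) k"
    unfolding splits_Un[OF UV] iffs side_ok_Void_Un ..
  have "(A \<subseteq> U \<and> A' \<subseteq> V \<and> side_ok Indep E (A \<union> A') \<and>
        clusters E ((U - A) \<union> (V - A')) k) \<longleftrightarrow>
      A \<subseteq> U \<and> A' \<subseteq> V \<and> (side_ok Indep E A \<and> side_ok Indep E A') \<and>
        clusters E ((U - A) \<union> (V - A')) k" for A A'
    using ok(1)[of A A'] by blast
  then show "splits Indep E (U \<union> V) k \<longleftrightarrow> par_splits (splits Indep E U) (splits Indep E V) k"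
    by (simp only: splits_Un[OF UV] iffs ex_disj_distrib)
  have "(A \<subseteq> U \<and> A' \<subseteq> V \<and> side_ok Multi E (A \<union> A') \<and>
        clusters E ((U - A) \<union> (V - A')) k) \<longleftrightarrow>
      A \<subseteq> U \<and> A' \<subseteq> V \<and> (side_ok Void E A \<and> side_ok Multi E A') \<and>
        clusters E ((U - A) \<union> (V - A')) k \<or>
      A \<subseteq> U \<and> A' \<subseteq> V \<and> (side_ok Multi E A \<and> side_ok Void E A') \<and>
        clusters E ((U - A) \<union> (V - A')) k \<or>
      A \<subseteq> U \<and> A' \<subseteq> V \<and> (side_ok Indep E A \<and> side_ok Indep E A') \<and>
        clusters E ((U - A) \<union> (V - A')) k" for A A'
    using ok(2)[of A A'] by blast
  then show "splits Multi E (U \<union> V) k \<longleftrightarrow>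
      par_splits (splits Void E U) (splits Multi E V) k \<or>
      par_splits (splits Multi E U) (splits Void E V) k \<or>
      par_splits (splits Indep E U) (splits Indep E V) k"
    by (simp only: splits_Un[OF UV] iffs ex_disj_distrib)
qed

lemma splits_ser:
  assumes "cross E True U V" "finite U" "finite V"
  shows "splits Void E (U \<union> V) k \<longleftrightarrow> ser_splits (splits Void E U) (splits Void E V) k"
    and "splits Indep E (U \<union> V) k \<longleftrightarrow>
      ser_splits (splits Void E U) (splits Indep E V) k \<or>
      ser_splits (splits Indep E U) (splits Void E V) k"
    and "splits Multi E (U \<union> V) k \<longleftrightarrow> ser_splits (splits Multi E U) (splits Multi E V) k"
proof -
  have UV: "U \<inter> V = {}" using assms(1) by (simp add: cross_def)
  note ok = side_ok_Un_all_edges[OF cross_mono[OF assms(1)]]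
  note iffs = ser_splits_clusters[OF assms, symmetric]
  show "splits Void E (U \<union> V) k \<longleftrightarrow> ser_splits (splits Void E U) (splits Void E V) k"
    unfolding splits_Un[OF UV] iffs side_ok_Void_Un ..
  have "(A \<subseteq> U \<and> A' \<subseteq> V \<and> side_ok Indep E (A \<union> A') \<and>
        clusters E ((U - A) \<union> (V - A')) k) \<longleftrightarrow>
      A \<subseteq> U \<and> A' \<subseteq> V \<and> (side_ok Void E A \<and> side_ok Indep E A') \<and>
        clusters E ((U - A) \<union> (V - A')) k \<or>
      A \<subseteq> U \<and> A' \<subseteq> V \<and> (side_ok Indep E A \<and> side_ok Void E A') \<and>
        clusters E ((U - A) \<union> (V - A')) k" for A A'
    using ok(1)[of A A'] by blast
  then show "splits Indep E (U \<union> V) k \<longleftrightarrow>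
      ser_splits (splits Void E U) (splits Indep E V) k \<or>
      ser_splits (splits Indep E U) (splits Void E V) k"
    by (simp only: splits_Un[OF UV] iffs ex_disj_distrib)
  have "(A \<subseteq> U \<and> A' \<subseteq> V \<and> side_ok Multi E (A \<union> A') \<and>
        clusters E ((U - A) \<union> (V - A')) k) \<longleftrightarrow>
      A \<subseteq> U \<and> A' \<subseteq> V \<and> (side_ok Multi E A \<and> side_ok Multi E A') \<and>
        clusters E ((U - A) \<union> (V - A')) k" for A A'
    using ok(2)[of A A'] by blast
  then show "splits Multi E (U \<union> V) k \<longleftrightarrow> ser_splits (splits Multi E U) (splits Multi E V) k"
    by (simp only: splits_Un[OF UV] iffs ex_disj_distrib)
qed

lemma splits_le: "splits m E W k \<Longrightarrow> k \<le> l \<Longrightarrow> splits m E W l"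
  unfolding splits_def using clusters_le by blast

text \<open>Restricting \<open>A\<close> and the remainder to \<open>W'\<close> keeps the shape and
  does not add cliques. This heredity makes proper subsets of obstructions polar and lets single
  deletions stand for all proper subsets.\<close>

lemma splits_mono:
  assumes "splits m E W k" "W' \<subseteq> W" "finite W"
  shows "splits m E W' k"
proof -
  obtain A where "A \<subseteq> W" "side_ok m E A" "clusters E (W - A) k"
    using assms(1) by (auto simp: splits_def)
  then have "side_ok m E (A \<inter> W')" "clusters E (W' - A \<inter> W') k"
    using assms side_ok_mono[of m E A "A \<inter> W'"] clusters_mono[of E "W - A" k "W' - A \<inter> W'"] by auto
  then show ?thesis unfolding splits_def by blast
qed

section \<open>Truncated levels and the composition table for states\<close>

type_synonym state = "nat \<times> nat \<times> nat"

text \<open>The least number of cliques, truncated at 3, which stands for more than two.\<close>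

definition level :: "(nat \<Rightarrow> bool) \<Rightarrow> nat \<Rightarrow> bool" where
  "level P n \<longleftrightarrow> n \<le> 3 \<and> (\<forall>k<3. P k \<longleftrightarrow> n \<le> k)"

definition has_state :: "'a rel \<Rightarrow> 'a set \<Rightarrow> state \<Rightarrow> bool" where
  "has_state E W = (\<lambda>(a, b, c).
     level (splits Void E W) a \<and> level (splits Indep E W) b \<and> level (splits Multi E W) c)"

lemma level_unique:
  assumes "level P m" "level P n"
  shows "m = n"
proof (rule ccontr)
  assume "m \<noteq> n"
  then have "min m n < 3" "(m \<le> min m n) \<noteq> (n \<le> min m n)"
    using assms by (auto simp: level_def)
  then show False using assms unfolding level_def by blast
qed

lemma level_exists:
  assumes "\<And>k l. P k \<Longrightarrow> k \<le> l \<Longrightarrow> P l"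
  shows "\<exists>n. level P n"
proof -
  \<comment> \<open>Admitting \<open>3\<close> as a fallback makes the least value exist even if
    \<open>P\<close> never holds.\<close>
  define n where "n = (LEAST k. k = 3 \<or> P k)"
  have n: "n = 3 \<or> P n" unfolding n_def by (rule LeastI[of _ 3]) simp
  have le: "n \<le> k" if "k = 3 \<or> P k" for k unfolding n_def using that by (rule Least_le)
  have "P k \<longleftrightarrow> n \<le> k" if "k < 3" for k
    using n le[of k] assms[of n k] that by auto
  then show ?thesis using le[of 3] by (auto simp: level_def)
qed

lemma has_state_unique: "has_state E W p \<Longrightarrow> has_state E W q \<Longrightarrow> p = q"
  by (auto simp: has_state_def dest: level_unique)

lemma has_state_exists: "\<exists>p. has_state E W p"
proof -
  have "\<exists>n. level (splits m E W) n" for m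
    using splits_le by (rule level_exists)
  then show ?thesis by (simp add: has_state_def)
qed

text \<open>For \<open>k < 3\<close> both shares \<open>i\<close> and \<open>k - i\<close> are below
  3, where a level determines its predicate, so truncation loses nothing.\<close>

lemma level_par:
  assumes "level P x" "level Q y"
  shows "level (par_splits P Q) (min 3 (x + y))"
proof -
  have "par_splits P Q k \<longleftrightarrow> min 3 (x + y) \<le> k" if "k < 3" for k
  proof -
    have "(i \<le> k \<and> P i \<and> Q (k - i)) \<longleftrightarrow> (i \<le> k \<and> x \<le> i \<and> y \<le> k - i)" for i
      using assms that by (auto simp: level_def)
    then have "par_splits P Q k \<longleftrightarrow> (\<exists>i\<le>k. x \<le> i \<and> y \<le> k - i)"
      by (simp add: par_splits_def)
    also have "\<dots> \<longleftrightarrow> x + y \<le> k" by (auto intro: exI[of _ x])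
    finally show ?thesis using that by auto
  qed
  then show ?thesis by (simp add: level_def)
qed

text \<open>Level 0 means that \<open>A\<close> takes the whole side, and then the other side is
  unrestricted. Two nonempty remainders in a join must form one clique; otherwise no number of
  cliques suffices, which is recorded as 3.\<close>

definition ser_level :: "nat \<Rightarrow> nat \<Rightarrow> nat" where
  "ser_level x y =
     (if x = 0 then y else if y = 0 then x else if x \<le> 1 \<and> y \<le> 1 then 1 else 3)"

lemma level_ser:
  assumes "level P x" "level Q y"
  shows "level (ser_splits P Q) (ser_level x y)"
proof -
  have PQ: "P k \<longleftrightarrow> x \<le> k" "Q k \<longleftrightarrow> y \<le> k" if "k < 3" for k
    using assms that by (auto simp: level_def)
  have "ser_splits P Q k \<longleftrightarrow> ser_level x y \<le> k" if "k < 3" for k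
    using PQ[of 0] PQ[of 1] PQ[of k] that unfolding ser_splits_def ser_level_def by auto
  moreover have "ser_level x y \<le> 3" using assms by (auto simp: level_def ser_level_def)
  ultimately show ?thesis by (simp add: level_def)
qed

lemma level_disj: "level P x \<Longrightarrow> level Q y \<Longrightarrow> level (\<lambda>k. P k \<or> Q k) (min x y)"
  by (auto simp: level_def)

text \<open>Components are in the order \<open>Void\<close>, \<open>Indep\<close>,
  \<open>Multi\<close>; each \<open>min\<close> ranges over the alternatives of
  \<open>splits_par\<close> or \<open>splits_ser\<close>.\<close>

fun combine :: "bool \<Rightarrow> state \<Rightarrow> state \<Rightarrow> state" where
  "combine False (a, b, c) (a', b', c') =
     (min 3 (a + a'), min 3 (b + b'), min (min 3 (a + c')) (min (min 3 (c + a')) (min 3 (b + b'))))"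
| "combine True (a, b, c) (a', b', c') =
     (ser_level a a', min (ser_level a b') (ser_level b a'), ser_level c c')"

text \<open>\<open>U\<close> or \<open>V\<close> may be empty; thus the table also covers a deletion
  that empties an operand.\<close>

lemma has_state_combine:
  assumes "cross E x U V" "finite U" "finite V" "has_state E U p" "has_state E V q"
  shows "has_state E (U \<union> V) (combine x p q)"
proof -
  obtain a b c a' b' c' where pq: "p = (a, b, c)" "q = (a', b', c')" by (cases p, cases q)
  note lv = assms(4,5)[unfolded pq has_state_def prod.case]
  have par: "splits Void E (U \<union> V) = par_splits (splits Void E U) (splits Void E V)"
    "splits Indep E (U \<union> V) = par_splits (splits Indep E U) (splits Indep E V)"
    "splits Multi E (U \<union> V) = (\<lambda>k. par_splits (splits Void E U) (splits Multi E V) k \<or>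
      par_splits (splits Multi E U) (splits Void E V) k \<or>
      par_splits (splits Indep E U) (splits Indep E V) k)" if "\<not> x"
    using splits_par[of E U V] assms(1-3) that by auto
  have ser: "splits Void E (U \<union> V) = ser_splits (splits Void E U) (splits Void E V)"
    "splits Indep E (U \<union> V) = (\<lambda>k. ser_splits (splits Void E U) (splits Indep E V) k \<or>
      ser_splits (splits Indep E U) (splits Void E V) k)"
    "splits Multi E (U \<union> V) = ser_splits (splits Multi E U) (splits Multi E V)" if x
    using splits_ser[of E U V] assms(1-3) that by auto
  show ?thesis
  proof (cases x)
    case True
    then show ?thesis
      using lv by (simp only: ser pq has_state_def combine.simps prod.case) (simp add: level_ser level_disj)
  next
    case False
    then show ?thesis
      using lv by (simp only: par pq has_state_def combine.simps prod.case not_False_eq_True)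
        (simp only: level_par level_disj simp_thms)
  qed
qed

lemma has_state_empty: "has_state E {} (0, 0, 0)"
proof -
  have "splits m E {} k" for m k
    by (cases m) (auto simp: splits_def clusters_def nonadj_trans_def P3_free_def)
  then show ?thesis by (simp add: has_state_def level_def)
qed

text \<open>A lone vertex costs a clique only when it may not be put into \<open>A\<close>.\<close>

lemma has_state_singleton:
  assumes "(x, x) \<notin> E"
  shows "has_state E {x} (1, 0, 0)"
proof -
  have "splits Void E {x} k \<longleftrightarrow> 1 \<le> k" for k
    by (auto simp: splits_def clusters_def P3_free_def clique_class_def)
  moreover have "splits Indep E {x} k" "splits Multi E {x} k" for k
    unfolding splits_def using assms
    by (auto intro!: exI[of _ "{x}"] simp: clusters_def nonadj_trans_def P3_free_def)
  ultimately show ?thesis by (auto simp: has_state_def level_def)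
qed

section \<open>States of a cotree and of its vertex deletions\<close>

primrec state_of :: "cotree \<Rightarrow> state" where
  "state_of Leaf = (1, 0, 0)"
| "state_of (Node b s t) = combine b (state_of s) (state_of t)"

text \<open>Works with states rather than smaller cotrees, because deleting a \<open>Leaf\<close>
  leaves the empty graph, which no cotree realizes. \<open>remdups\<close> keeps the lists short for
  evaluation.\<close>

primrec deletion_states :: "cotree \<Rightarrow> state list" where
  "deletion_states Leaf = [(0, 0, 0)]"
| "deletion_states (Node b s t) = remdups
     (map (\<lambda>p. combine b p (state_of t)) (deletion_states s) @
      map (\<lambda>p. combine b (state_of s) p) (deletion_states t))"

lemma has_state_of: "realizes t E W \<Longrightarrow> has_state E W (state_of t)"
proof (induction t arbitrary: W)
  case Leaf
  then show ?case using has_state_singleton by auto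
next
  case (Node b s t)
  from Node.prems show ?case
    by (rule realizes_NodeE) (simp add: has_state_combine Node.IH realizes_finite)
qed

text \<open>A deleted vertex lies in exactly one operand, and the other operand keeps its state. The
  converse rests on uniqueness of states: whichever state \<open>q\<close> the reduced operand has,
  \<open>p\<close> must be the table entry for it.\<close>

lemma has_state_deletion:
  "realizes t E W \<Longrightarrow> p \<in> set (deletion_states t) \<longleftrightarrow> (\<exists>x\<in>W. has_state E (W - {x}) p)"
proof (induction t arbitrary: W p)
  case Leaf
  then show ?case using has_state_empty[of E] has_state_unique by fastforce
next
  case (Node b s t)
  obtain U V where UV: "W = U \<union> V" "cross E b U V" "realizes s E U" "realizes t E V"
    using Node.prems by (rule realizes_NodeE)
  have fin: "finite U" "finite V" using UV realizes_finite by auto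
  have disj: "U \<inter> V = {}" using UV(2) by (simp add: cross_def)
  have U: "has_state E (W - {x}) (combine b q (state_of t))" if "x \<in> U" "has_state E (U - {x}) q" for x q
  proof -
    have "W - {x} = (U - {x}) \<union> V" using UV(1) disj that(1) by auto
    moreover have "cross E b (U - {x}) V" using UV(2) by (rule cross_mono) auto
    ultimately show ?thesis
      using that fin has_state_of[OF UV(4)] by (simp add: has_state_combine)
  qed
  have V: "has_state E (W - {x}) (combine b (state_of s) q)" if "x \<in> V" "has_state E (V - {x}) q" for x q
  proof -
    have "W - {x} = U \<union> (V - {x})" using UV(1) disj that(1) by auto
    moreover have "cross E b U (V - {x})" using UV(2) by (rule cross_mono) auto
    ultimately show ?thesis
      using that fin has_state_of[OF UV(3)] by (simp add: has_state_combine)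
  qed
  show ?case
  proof
    assume "p \<in> set (deletion_states (Node b s t))"
    then consider q where "p = combine b q (state_of t)" "q \<in> set (deletion_states s)"
      | q where "p = combine b (state_of s) q" "q \<in> set (deletion_states t)"
      by auto
    then show "\<exists>x\<in>W. has_state E (W - {x}) p"
    proof cases
      case 1
      then show ?thesis using Node.IH(1)[OF UV(3)] U UV(1) by blast
    next
      case 2
      then show ?thesis using Node.IH(2)[OF UV(4)] V UV(1) by blast
    qed
  next
    assume "\<exists>x\<in>W. has_state E (W - {x}) p"
    then obtain x where x: "x \<in> W" "has_state E (W - {x}) p" by blast
    show "p \<in> set (deletion_states (Node b s t))"
    proof (cases "x \<in> U")
      case True
      obtain q where q: "has_state E (U - {x}) q" using has_state_exists by blast
      then have "p = combine b q (state_of t)" using U[OF True] x(2) has_state_unique by blast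
      moreover have "q \<in> set (deletion_states s)" using Node.IH(1)[OF UV(3)] q True by blast
      ultimately show ?thesis by simp
    next
      case False
      then have xV: "x \<in> V" using x UV(1) by simp
      obtain q where q: "has_state E (V - {x}) q" using has_state_exists by blast
      then have "p = combine b (state_of s) q" using V[OF xV] x(2) has_state_unique by blast
      moreover have "q \<in> set (deletion_states t)" using Node.IH(2)[OF UV(4)] q xV by blast
      ultimately show ?thesis by simp
    qed
  qed
qed

section \<open>Critical sets\<close>

definition critical :: "'a rel \<Rightarrow> 'a set \<Rightarrow> bool" where
  "critical E W \<longleftrightarrow> (\<forall>x\<in>W. \<forall>p. has_state E W p \<longrightarrow> \<not> has_state E (W - {x}) p)"

text \<open>Contrapositive of compositionality: a deletion in \<open>U\<close> that preserves the
  state of \<open>U\<close> preserves that of \<open>U \<union> V\<close>.\<close>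

lemma critical_part:
  assumes "critical E (U \<union> V)" "cross E b U V" "finite U" "finite V"
  shows "critical E U"
  unfolding critical_def
proof (intro ballI allI impI notI)
  fix x p
  assume x: "x \<in> U" "has_state E U p" "has_state E (U - {x}) p"
  obtain q where q: "has_state E V q" using has_state_exists by blast
  have eq: "(U - {x}) \<union> V = U \<union> V - {x}" using x assms(2) by (auto simp: cross_def)
  have "cross E b (U - {x}) V" using assms(2) by (rule cross_mono) auto
  then have "has_state E (U \<union> V - {x}) (combine b p q)"
    using has_state_combine[of E b "U - {x}" V p q] x q assms(3,4) by (simp add: eq)
  moreover have "has_state E (U \<union> V) (combine b p q)"
    using has_state_combine assms x q by blast
  ultimately show False using assms(1) x(1) unfolding critical_def by blast
qed

lemma realizes_critical:
  assumes "realizes t E W"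
  shows "critical E W \<longleftrightarrow> state_of t \<notin> set (deletion_states t)"
  using has_state_of[OF assms] has_state_deletion[OF assms] has_state_unique
  unfolding critical_def by metis

text \<open>Minimality is tested on single deletions only; \<open>obstruction_iff\<close> extends it
  to all proper subsets by heredity.\<close>

definition polar_obstruction :: "'a rel \<Rightarrow> 'a set \<Rightarrow> bool" where
  "polar_obstruction E W \<longleftrightarrow>
     \<not> splits Multi E W 2 \<and> (\<forall>x\<in>W. splits Multi E (W - {x}) 2)"

lemma has_state_splits: "has_state E W p \<Longrightarrow> splits Multi E W 2 \<longleftrightarrow> snd (snd p) \<le> 2"
  by (auto simp: has_state_def level_def)

lemma realizes_obstruction:
  assumes "realizes t E W"
  shows "polar_obstruction E W \<longleftrightarrow>
    \<not> snd (snd (state_of t)) \<le> 2 \<and> (\<forall>p\<in>set (deletion_states t). snd (snd p) \<le> 2)"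
proof -
  have "(\<forall>x\<in>W. splits Multi E (W - {x}) 2) \<longleftrightarrow> (\<forall>p\<in>set (deletion_states t). snd (snd p) \<le> 2)"
    using has_state_deletion[OF assms] has_state_splits has_state_exists by metis
  then show ?thesis
    using has_state_splits[OF has_state_of[OF assms]] by (simp add: polar_obstruction_def)
qed

text \<open>Each deletion moves the third component of the state from above 2 to at most 2.\<close>

lemma polar_obstruction_critical: "polar_obstruction E W \<Longrightarrow> critical E W"
  unfolding polar_obstruction_def critical_def using has_state_splits by blast

text \<open>The critical cotrees of polar cographs, found by closing \<open>Leaf\<close> under those unions and
  joins of critical cotrees that are again critical and polar.\<close>

definition critical_trees :: "cotree list" where
  "critical_trees =
     [Leaf,
      Par Leaf Leaf,
      Ser Leaf Leaf,
      Par Leaf (Par Leaf Leaf),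
      Ser Leaf (Par Leaf Leaf),
      Ser (Par Leaf Leaf) (Par Leaf Leaf),
      Par Leaf (Ser Leaf Leaf),
      Par Leaf (Par Leaf (Ser Leaf Leaf)),
      Par (Ser Leaf Leaf) (Ser Leaf Leaf),
      Ser (Par Leaf (Par Leaf Leaf)) (Par Leaf (Par Leaf Leaf)),
      Par Leaf (Ser Leaf (Par Leaf Leaf)),
      Ser Leaf (Ser (Par Leaf Leaf) (Par Leaf Leaf)),
      Par (Ser Leaf Leaf) (Ser Leaf (Par Leaf Leaf)),
      Par (Ser Leaf (Par Leaf Leaf)) (Ser Leaf (Par Leaf Leaf)),
      Par Leaf (Ser (Par Leaf Leaf) (Par Leaf Leaf)),
      Par Leaf (Par Leaf (Ser (Par Leaf Leaf) (Par Leaf Leaf))),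
      Par (Ser Leaf Leaf) (Ser (Par Leaf Leaf) (Par Leaf Leaf)),
      Ser Leaf (Par Leaf (Ser Leaf Leaf)),
      Ser (Par Leaf Leaf) (Par Leaf (Ser Leaf Leaf)),
      Par Leaf (Par (Ser Leaf Leaf) (Ser Leaf Leaf)),
      Ser Leaf (Ser (Par Leaf Leaf) (Par Leaf (Ser Leaf Leaf))),
      Par Leaf (Par (Ser Leaf Leaf) (Ser (Par Leaf Leaf) (Par Leaf Leaf))),
      Ser (Par Leaf (Ser Leaf Leaf)) (Par Leaf (Ser Leaf Leaf)),
      Ser (Par Leaf Leaf) (Par Leaf (Par Leaf (Ser Leaf Leaf))),
      Ser Leaf (Par (Ser Leaf Leaf) (Ser Leaf Leaf)),
      Par (Ser Leaf Leaf) (Par (Ser Leaf Leaf) (Ser Leaf Leaf)),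
      Ser Leaf (Ser Leaf (Par (Ser Leaf Leaf) (Ser Leaf Leaf))),
      Par Leaf (Ser (Par Leaf (Par Leaf Leaf)) (Par Leaf (Par Leaf Leaf))),
      Par Leaf (Par Leaf (Ser (Par Leaf (Par Leaf Leaf)) (Par Leaf (Par Leaf Leaf)))),
      Ser (Par Leaf Leaf) (Par Leaf (Ser Leaf (Par Leaf Leaf))),
      Par Leaf (Ser Leaf (Ser (Par Leaf Leaf) (Par Leaf Leaf))),
      Par Leaf (Par Leaf (Ser Leaf (Ser (Par Leaf Leaf) (Par Leaf Leaf)))),
      Ser Leaf (Par (Ser Leaf Leaf) (Ser Leaf (Par Leaf Leaf))),
      Ser Leaf (Par (Ser Leaf (Par Leaf Leaf)) (Ser Leaf (Par Leaf Leaf))),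
      Ser Leaf (Par Leaf (Ser (Par Leaf Leaf) (Par Leaf Leaf))),
      Ser Leaf (Par Leaf (Par Leaf (Ser (Par Leaf Leaf) (Par Leaf Leaf)))),
      Par Leaf (Ser (Par Leaf Leaf) (Par Leaf (Ser Leaf Leaf))),
      Par (Ser Leaf Leaf) (Ser (Par Leaf Leaf) (Par Leaf (Ser Leaf Leaf))),
      Ser Leaf (Par Leaf (Par (Ser Leaf Leaf) (Ser Leaf Leaf))),
      Par Leaf (Ser Leaf (Ser (Par Leaf Leaf) (Par Leaf (Ser Leaf Leaf)))),
      Par Leaf (Ser (Par Leaf (Ser Leaf Leaf)) (Par Leaf (Ser Leaf Leaf))),
      Par Leaf (Ser (Par Leaf Leaf) (Par Leaf (Par Leaf (Ser Leaf Leaf)))),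
      Par Leaf (Ser Leaf (Ser Leaf (Par (Ser Leaf Leaf) (Ser Leaf Leaf)))),
      Par Leaf (Ser (Par Leaf Leaf) (Par Leaf (Ser Leaf (Par Leaf Leaf)))),
      Par Leaf (Ser Leaf (Par (Ser Leaf Leaf) (Ser Leaf (Par Leaf Leaf)))),
      Par Leaf (Ser Leaf (Par Leaf (Ser (Par Leaf Leaf) (Par Leaf Leaf)))),
      Ser Leaf (Par Leaf (Ser (Par Leaf Leaf) (Par Leaf (Ser Leaf Leaf))))]"

text \<open>Normal forms of the non-polar nodes that arise from two critical polar trees and become
  polar under every deletion. \<open>listed_trees_nf\<close> identifies them with the listed
  graphs.\<close>

definition obstruction_trees :: "cotree list" where
  "obstruction_trees =
     [Par (Ser Leaf (Par Leaf Leaf)) (Ser (Par Leaf Leaf) (Par Leaf Leaf)),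
      Par Leaf (Par Leaf (Par (Ser Leaf Leaf) (Ser (Par Leaf Leaf) (Par Leaf Leaf)))),
      Par Leaf (Par (Ser Leaf Leaf) (Par (Ser Leaf Leaf) (Ser Leaf Leaf))),
      Par Leaf (Par Leaf (Par Leaf (Ser (Par Leaf (Par Leaf Leaf)) (Par Leaf (Par Leaf Leaf))))),
      Par Leaf (Par Leaf (Par Leaf (Ser Leaf (Ser (Par Leaf Leaf) (Par Leaf Leaf))))),
      Par (Ser Leaf Leaf) (Par (Ser Leaf (Par Leaf Leaf)) (Ser Leaf (Par Leaf Leaf))),
      Ser (Par Leaf (Ser Leaf Leaf)) (Par (Ser Leaf (Par Leaf Leaf)) (Ser Leaf (Par Leaf Leaf))),
      Ser (Par Leaf (Ser Leaf Leaf)) (Par Leaf (Par Leaf (Ser (Par Leaf Leaf) (Par Leaf Leaf)))),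
      Par Leaf (Par (Ser Leaf Leaf) (Ser (Par Leaf Leaf) (Par Leaf (Ser Leaf Leaf)))),
      Ser (Par Leaf (Ser Leaf Leaf)) (Par Leaf (Par (Ser Leaf Leaf) (Ser Leaf Leaf))),
      Par Leaf (Par Leaf (Ser Leaf (Ser (Par Leaf Leaf) (Par Leaf (Ser Leaf Leaf))))),
      Par Leaf (Par Leaf (Ser (Par Leaf (Ser Leaf Leaf)) (Par Leaf (Ser Leaf Leaf)))),
      Par Leaf (Par Leaf (Ser (Par Leaf Leaf) (Par Leaf (Par Leaf (Ser Leaf Leaf))))),
      Par (Ser Leaf (Par Leaf Leaf)) (Ser Leaf (Par (Ser Leaf Leaf) (Ser Leaf Leaf))),
      Par Leaf (Par Leaf (Ser Leaf (Ser Leaf (Par (Ser Leaf Leaf) (Ser Leaf Leaf))))),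
      Par Leaf (Par Leaf (Ser (Par Leaf Leaf) (Par Leaf (Ser Leaf (Par Leaf Leaf))))),
      Par Leaf (Par Leaf (Ser Leaf (Par (Ser Leaf Leaf) (Ser Leaf (Par Leaf Leaf))))),
      Par Leaf (Ser Leaf (Par (Ser Leaf (Par Leaf Leaf)) (Ser Leaf (Par Leaf Leaf)))),
      Par Leaf (Par Leaf (Ser Leaf (Par Leaf (Ser (Par Leaf Leaf) (Par Leaf Leaf))))),
      Par Leaf (Ser Leaf (Par Leaf (Par Leaf (Ser (Par Leaf Leaf) (Par Leaf Leaf))))),
      Ser (Par Leaf (Ser Leaf Leaf)) (Par Leaf (Ser (Par Leaf Leaf) (Par Leaf (Ser Leaf Leaf)))),
      Par Leaf (Ser Leaf (Par Leaf (Par (Ser Leaf Leaf) (Ser Leaf Leaf)))),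
      Par Leaf (Ser Leaf (Par Leaf (Ser (Par Leaf Leaf) (Par Leaf (Ser Leaf Leaf)))))]"

section \<open>The finite closure check and its consequences\<close>

type_synonym row = "cotree \<times> state \<times> state list"

text \<open>The harmless outcomes for a node: some deletion keeps its state, so it is not critical;
  it is polar, and closure demands a known tree; it is not polar, and then it is not minimal or must
  be listed. The listed operands are already sorted, so \<open>merge_children\<close> alone yields
  the normal form.\<close>

fun check_pair :: "row \<Rightarrow> row \<Rightarrow> bool \<Rightarrow> bool" where
  "check_pair (s, p, ps) (t, q, qs) b =
     (let r = combine b p q; rs = map (\<lambda>p'. combine b p' q) ps @ map (combine b p) qs
      in r \<in> set rs \<or>
        (if snd (snd r) \<le> 2 then merge_children b s t \<in> set critical_trees
         else list_ex (\<lambda>p. \<not> snd (snd p) \<le> 2) rs \<or> merge_children b s t \<in> set obstruction_trees))"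

text \<open>Unordered pairs, each tree also with itself, suffice because operands commute.\<close>

fun check_all :: "row list \<Rightarrow> bool" where
  "check_all [] = True"
| "check_all (x # xs) =
     (list_all (\<lambda>y. check_pair x y False \<and> check_pair x y True) (x # xs) \<and> check_all xs)"

text \<open>Stores state and deletion states with each tree, so that the check combines stored
  values for every pair.\<close>

definition row_of :: "cotree \<Rightarrow> row" where
  "row_of t = (t, state_of t, deletion_states t)"

lemma check_all_critical: "check_all (map row_of critical_trees)"
  by code_simp

lemma check_allD:
  "check_all rs \<Longrightarrow> x \<in> set rs \<Longrightarrow> y \<in> set rs \<Longrightarrow> check_pair x y b \<or> check_pair y x b"
  by (induction rs) (cases b; auto simp: list_all_iff)+

text \<open>Soundness of the check: criticality rules out its first outcome, so polarity leads into
  \<open>critical_trees\<close> and minimal non-polarity into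
  \<open>obstruction_trees\<close>.\<close>

lemma critical_pair:
  assumes "s \<in> set critical_trees" "t \<in> set critical_trees" "realizes (Node b s t) E W" "critical E W"
  shows "splits Multi E W 2 \<Longrightarrow> \<exists>r\<in>set critical_trees. realizes r E W"
    and "polar_obstruction E W \<Longrightarrow> \<exists>r\<in>set obstruction_trees. realizes r E W"
proof -
  \<comment> \<open>The pair may have been checked in the opposite order; the node is then realized
    with its operands swapped.\<close>
  have "check_pair (row_of s) (row_of t) b \<or> check_pair (row_of t) (row_of s) b"
    using assms(1,2) by (intro check_allD[OF check_all_critical]) auto
  then obtain s' t' where chk: "check_pair (row_of s') (row_of t') b"
    and real: "realizes (Node b s' t') E W"
    using assms(3) realizes_commute by blast
  let ?r = "Node b s' t'"
  define rs where "rs = map (\<lambda>p. combine b p (state_of t')) (deletion_states s') @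
    map (combine b (state_of s')) (deletion_states t')"
  have rs: "set rs = set (deletion_states ?r)" by (simp add: rs_def)
  have "state_of ?r \<notin> set rs"
    using realizes_critical[OF real] assms(4) rs by blast
  with chk have chk': "if snd (snd (state_of ?r)) \<le> 2 then merge_children b s' t' \<in> set critical_trees
      else (\<exists>p\<in>set rs. \<not> snd (snd p) \<le> 2) \<or> merge_children b s' t' \<in> set obstruction_trees"
    unfolding row_of_def check_pair.simps Let_def rs_def[symmetric] state_of.simps list_ex_iff by blast
  have real': "realizes (merge_children b s' t') E W"
    using real by (rule realizes_merge_children)
  show "\<exists>r\<in>set critical_trees. realizes r E W" if "splits Multi E W 2"
    using that chk' real' has_state_splits[OF has_state_of[OF real]] by auto
  show "\<exists>r\<in>set obstruction_trees. realizes r E W" if "polar_obstruction E W"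
    using that chk' real' unfolding realizes_obstruction[OF real] rs by auto
qed

lemma critical_split:
  assumes "finite W" "card W \<ge> 2" "sym E" "P4_free E W" "critical E W"
  obtains b U V where "cross E b U V" "W = U \<union> V" "U \<subset> W" "V \<subset> W" "U \<noteq> {}" "V \<noteq> {}"
    "critical E U" "critical E V"
proof -
  obtain b U V where *: "cross E b U V" "W = U \<union> V" "U \<noteq> {}" "V \<noteq> {}"
    using P4_free_cross[OF assms(1-4)] by blast
  then have "critical E U" "critical E V"
    using critical_part[of E U V b] critical_part[of E V U b] assms(1,5)
    by (auto simp: Un_commute cross_commute[of E b V])
  moreover have "U \<subset> W" "V \<subset> W" using * by (auto simp: cross_def)
  ultimately show thesis using that * by blast
qed

text \<open>By induction on the vertex set: criticality passes to the operands by
  \<open>critical_part\<close>, polarity by heredity, and the check closes the list.\<close>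

lemma critical_realized:
  assumes "finite W" "W \<noteq> {}" "sym E" "irrefl E" "P4_free E W" "critical E W" "splits Multi E W 2"
  shows "\<exists>t\<in>set critical_trees. realizes t E W"
  using assms(1,2,5-7)
proof (induction W rule: finite_psubset_induct)
  case (psubset W)
  show ?case
  proof (cases "card W \<ge> 2")
    case True
    then obtain b U V where *: "cross E b U V" "W = U \<union> V" "U \<subset> W" "V \<subset> W" "U \<noteq> {}" "V \<noteq> {}"
      "critical E U" "critical E V"
      using critical_split psubset assms(3) by metis
    have "\<exists>t\<in>set critical_trees. realizes t E X" if "X \<subset> W" "X \<noteq> {}" "critical E X" for X
      using that psubset P4_free_mono[of E W X] splits_mono[of Multi E W 2 X] by auto
    then obtain s t where "s \<in> set critical_trees" "realizes s E U" "t \<in> set critical_trees" "realizes t E V"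
      using * by meson
    then show ?thesis
      using critical_pair(1)[of s t b E W] realizes_NodeI[of E b U V s t] * psubset by simp
  next
    case False
    moreover have "card W > 0" using psubset by (simp add: card_gt_0_iff)
    ultimately have "card W = 1" by linarith
    then obtain x where "W = {x}" by (rule card_1_singletonE)
    then have "realizes Leaf E W" using assms(4) by (auto simp: irrefl_def)
    moreover have "Leaf \<in> set critical_trees" by (simp add: critical_trees_def)
    ultimately show ?thesis by blast
  qed
qed

lemma obstruction_realized:
  assumes "finite W" "sym E" "irrefl E" "P4_free E W" "polar_obstruction E W"
  shows "\<exists>t\<in>set obstruction_trees. realizes t E W"
proof -
  have crit: "critical E W" using assms(5) by (rule polar_obstruction_critical)
  \<comment> \<open>Sets with at most one vertex are polar, so an obstruction is large enough to be
    decomposed.\<close>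
  have "splits Multi E W 2" if "card W \<le> 1"
  proof (cases "W = {}")
    case True
    then show ?thesis using has_state_splits[OF has_state_empty] by simp
  next
    case False
    then have "card W > 0" using assms(1) by (simp add: card_gt_0_iff)
    with that have "card W = 1" by linarith
    then obtain x where "W = {x}" by (rule card_1_singletonE)
    then show ?thesis
      using has_state_splits[OF has_state_singleton, of x E] assms(3) by (simp add: irrefl_def)
  qed
  then have "card W \<ge> 2" using assms(5) by (fastforce simp: polar_obstruction_def)
  then obtain b U V where *: "cross E b U V" "W = U \<union> V" "U \<subset> W" "V \<subset> W" "U \<noteq> {}" "V \<noteq> {}"
      "critical E U" "critical E V"
    using critical_split[OF assms(1) _ assms(2,4) crit] by blast
  have "\<exists>t\<in>set critical_trees. realizes t E X" if X: "X \<subset> W" "X \<noteq> {}" "critical E X" for X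
  proof -
    obtain x where x: "x \<in> W" "X \<subseteq> W - {x}" using X(1) by blast
    then have "splits Multi E X 2"
      using assms(1,5) splits_mono[of Multi E "W - {x}" 2 X] by (auto simp: polar_obstruction_def)
    then show ?thesis
      using critical_realized[of X E] X assms P4_free_mono[of E W X] finite_subset[of X W] by auto
  qed
  then obtain s t where "s \<in> set critical_trees" "realizes s E U" "t \<in> set critical_trees" "realizes t E V"
    using * by meson
  then show ?thesis
    using critical_pair(2)[of s t b E W] realizes_NodeI[of E b U V s t] * crit assms(5) by simp
qed

text \<open>The converse inclusion: the check bounds the obstructions from above, while this
  evaluates every listed tree and finds a true obstruction.\<close>

lemma obstruction_trees_obstruct:
  assumes "t \<in> set obstruction_trees" "realizes t E W"
  shows "polar_obstruction E W"
proof -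
  have "list_all (\<lambda>t. \<not> snd (snd (state_of t)) \<le> 2 \<and>
      list_all (\<lambda>p. snd (snd p) \<le> 2) (deletion_states t)) obstruction_trees"
    by code_simp
  then show ?thesis
    using assms realizes_obstruction[OF assms(2)] by (simp add: list_all_iff)
qed

section \<open>Polar partitions\<close>

lemma verts_induced [simp]: "verts (induced G W) = W"
  and edges_induced [simp]: "edges (induced G W) = edges G \<inter> W \<times> W"
  by (simp_all add: induced_def)

text \<open>The parts are the classes of non-adjacency, an equivalence relation on \<open>A\<close>.
  The bound \<open>\<infinity>\<close> holds for any number of parts.\<close>

lemma complete_multipartite_iff:
  assumes "sym (edges G)" "irrefl (edges G)"
  shows "complete_multipartite_at_most \<infinity> (induced G A) \<longleftrightarrow> nonadj_trans (edges G) A"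
proof
  assume "complete_multipartite_at_most \<infinity> (induced G A)"
  then obtain \<P> where P: "partition_on A \<P>"
    and P_adj: "\<forall>u\<in>A. \<forall>v\<in>A. (u, v) \<in> edges G \<inter> A \<times> A \<longleftrightarrow> \<not> (\<exists>X\<in>\<P>. u \<in> X \<and> v \<in> X)"
    unfolding complete_multipartite_at_most_def verts_induced edges_induced
    by (elim exE conjE) (rule that)
  have adj: "(u, v) \<in> edges G \<longleftrightarrow> \<not> (\<exists>X\<in>\<P>. u \<in> X \<and> v \<in> X)" if "u \<in> A" "v \<in> A" for u v
    using P_adj[rule_format, OF that] that by simp
  show "nonadj_trans (edges G) A"
    unfolding nonadj_trans_def
  proof (intro ballI impI)
    fix u v w
    assume *: "u \<in> A" "v \<in> A" "w \<in> A" "(u, v) \<notin> edges G" "(v, w) \<notin> edges G"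
    then obtain X Y where XY: "X \<in> \<P>" "u \<in> X" "v \<in> X" "Y \<in> \<P>" "v \<in> Y" "w \<in> Y"
      using adj[of u v] adj[of v w] by blast
    then have "X = Y" using P unfolding partition_on_def disjoint_def by blast
    then show "(u, w) \<notin> edges G" using adj[of u w] * XY by blast
  qed
next
  assume trans: "nonadj_trans (edges G) A"
  define r where "r = {(u, v) \<in> A \<times> A. (u, v) \<notin> edges G}"
  have "equiv A r"
  proof (rule equivI)
    show "r \<subseteq> A \<times> A" by (auto simp: r_def)
    show "refl_on A r" using assms(2) by (auto simp: r_def refl_on_def irrefl_def)
    show "sym r" using assms(1) by (auto simp: r_def sym_def)
    show "trans r"
    proof (rule transI)
      fix u v w
      assume "(u, v) \<in> r" "(v, w) \<in> r"
      then show "(u, w) \<in> r" using nonadj_transD[OF trans, of u v w] by (auto simp: r_def)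
    qed
  qed
  moreover have "(u, v) \<in> edges G \<longleftrightarrow> \<not> (\<exists>X\<in>A // r. u \<in> X \<and> v \<in> X)" if "u \<in> A" "v \<in> A" for u v
  proof -
    have "(\<exists>X\<in>A // r. u \<in> X \<and> v \<in> X) \<longleftrightarrow> (u, v) \<in> r"
    proof
      assume "\<exists>X\<in>A // r. u \<in> X \<and> v \<in> X"
      then obtain X where "X \<in> A // r" "u \<in> X" "v \<in> X" by blast
      then show "(u, v) \<in> r" using quotient_eq_iff[OF \<open>equiv A r\<close>, of X X u v] by simp
    next
      assume "(u, v) \<in> r"
      moreover have "u \<in> r `` {u}" using \<open>equiv A r\<close> that(1) by (rule equiv_class_self)
      moreover have "r `` {u} \<in> A // r" using that(1) by (rule quotientI)
      ultimately show "\<exists>X\<in>A // r. u \<in> X \<and> v \<in> X" by blast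
    qed
    then show ?thesis using that by (simp add: r_def)
  qed
  ultimately show "complete_multipartite_at_most \<infinity> (induced G A)"
    unfolding complete_multipartite_at_most_def
    by (intro exI[of _ "A // r"]) (simp add: partition_on_quotient)
qed

lemma components_eq: "components G = (\<lambda>u. {v \<in> verts G. (u, v) \<in> (edges G)\<^sup>*}) ` verts G"
  unfolding components_def quotient_def by auto

lemma rtrancl_P3_free:
  assumes "P3_free E B" "u \<in> B" "(u, v) \<in> (E \<inter> B \<times> B)\<^sup>*"
  shows "u = v \<or> (u, v) \<in> E"
  using assms(3)
proof (induction rule: rtrancl_induct)
  case (step v w)
  then show ?case using P3_freeD[OF assms(1), of u v w] assms(2) by auto
qed simp

text \<open>In a P3-free set reachability contracts to equality or adjacency, so components are
  closed neighbourhoods. Conversely, the ends of a path \<open>u v w\<close> share a component, and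
  completeness makes them adjacent.\<close>

lemma cluster_iff:
  assumes "sym (edges G)"
  shows "cluster (induced G B) \<and> card (components (induced G B)) \<le> k \<longleftrightarrow> clusters (edges G) B k"
proof -
  let ?E = "edges G"
  have P3_free: "P3_free ?E B" if "cluster (induced G B)"
    unfolding P3_free_def
  proof (intro ballI impI)
    fix u v w
    assume *: "u \<in> B" "v \<in> B" "w \<in> B" "(u, v) \<in> ?E" "(v, w) \<in> ?E" "u \<noteq> w"
    let ?C = "{x \<in> B. (u, x) \<in> (?E \<inter> B \<times> B)\<^sup>*}"
    have "?C \<in> components (induced G B)" using * by (auto simp: components_eq)
    moreover have "(u, v) \<in> ?E \<inter> B \<times> B" "(v, w) \<in> ?E \<inter> B \<times> B" using * by auto
    then have "(u, w) \<in> (?E \<inter> B \<times> B)\<^sup>*" by (meson r_into_rtrancl rtrancl_trans)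
    then have "u \<in> ?C" "w \<in> ?C" using * by auto
    ultimately show "(u, w) \<in> ?E"
      using that *(6) unfolding cluster_def complete_graph_def by fastforce
  qed
  have comps: "components (induced G B) = clique_class ?E B ` B" if "P3_free ?E B"
  proof -
    have "{v \<in> B. (u, v) \<in> (?E \<inter> B \<times> B)\<^sup>*} = clique_class ?E B u" if "u \<in> B" for u
      using rtrancl_P3_free[OF \<open>P3_free ?E B\<close> that] that by (auto simp: clique_class_def)
    then show ?thesis by (simp add: components_eq)
  qed
  have "cluster (induced G B)" if free: "P3_free ?E B"
    unfolding cluster_def complete_graph_def
  proof (intro ballI impI)
    fix W u w
    assume *: "W \<in> components (induced G B)" "u \<in> verts (induced (induced G B) W)"
      "w \<in> verts (induced (induced G B) W)" "u \<noteq> w"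
    then obtain v where v: "v \<in> B" "W = clique_class ?E B v" using comps[OF free] by auto
    have "(u, v) \<in> ?E \<or> u = v" "(v, w) \<in> ?E \<or> v = w" "u \<in> B" "w \<in> B"
      using * v symD[OF assms] by (auto simp: clique_class_def)
    then have "(u, w) \<in> ?E" using P3_freeD[OF free, of u v w] v *(4) by auto
    then show "(u, w) \<in> edges (induced (induced G B) W)"
      using * v by (auto simp: clique_class_def)
  qed
  then show ?thesis using P3_free comps unfolding clusters_def by auto
qed

text \<open>\<open>B\<close> must be \<open>W - A\<close>, so a polar partition is just a choice of
  \<open>A\<close>; nested induced subgraphs collapse to subsets inside
  \<open>edges G\<close>.\<close>

lemma polar_iff_splits:
  assumes "simple_graph G"
  shows "polar \<infinity> 2 (induced G W) \<longleftrightarrow> splits Multi (edges G) W 2"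
proof -
  have sym: "sym (edges G)" and irrefl: "irrefl (edges G)"
    using assms by (auto simp: simple_graph_def)
  have induced: "induced (induced G W) A = induced G A" if "A \<subseteq> W" for A
    using that by (auto simp: induced_def)
  have enat: "enat n \<le> 2 \<longleftrightarrow> n \<le> 2" for n
    using enat_ord_simps(1)[of n 2] by (simp add: numeral_eq_enat)
  have part: "polar_partition \<infinity> 2 (induced G W) A B \<longleftrightarrow>
      A \<subseteq> W \<and> B = W - A \<and> side_ok Multi (edges G) A \<and> clusters (edges G) B 2" for A B
  proof (cases "A \<subseteq> W \<and> B = W - A")
    case True
    then have ind: "induced (induced G W) A = induced G A" "induced (induced G W) B = induced G B"
      using induced by blast+
    have "A \<union> B = W" "A \<inter> B = {}" using True by auto
    then show ?thesis
      unfolding polar_partition_def enat ind side_ok.simps verts_induced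
        complete_multipartite_iff[OF sym irrefl] cluster_iff[OF sym] using True by simp
  next
    case False
    then have "\<not> (A \<union> B = W \<and> A \<inter> B = {})" by blast
    with False show ?thesis unfolding polar_partition_def verts_induced by blast
  qed
  show ?thesis unfolding polar_def splits_def part by simp
qed

lemma cograph_iff_P4_free:
  assumes "simple_graph G"
  shows "cograph G \<longleftrightarrow> P4_free (edges G) (verts G)"
proof -
  let ?E = "edges G"
  have sym: "(u, v) \<in> ?E \<longleftrightarrow> (v, u) \<in> ?E" for u v
    using assms by (auto simp: simple_graph_def dest: symD)
  have irrefl: "(u, u) \<notin> ?E" for u
    using assms by (auto simp: simple_graph_def irrefl_def)
  have lt4: "{..<4::nat} = {0, 1, 2, 3}" by auto
  have "\<not> P4_free ?E (verts G)" if W: "W \<subseteq> verts G" "induced G W \<cong> Pn 4" for W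
  proof -
    obtain f where f: "bij_betw f W {..<4}"
      and f_adj: "\<forall>u\<in>W. \<forall>v\<in>W. (u, v) \<in> ?E \<inter> W \<times> W \<longleftrightarrow> (f u, f v) \<in> edges (Pn 4)"
    proof -
      have "verts (Pn 4) = {..<4}" by (simp add: Pn_def)
      then show thesis
        using W(2) that unfolding isomorphic_def verts_induced edges_induced by metis
    qed
    have adj: "(u, v) \<in> ?E \<longleftrightarrow> (f u, f v) \<in> edges (Pn 4)" if "u \<in> W" "v \<in> W" for u v
      using f_adj[rule_format, OF that] that by simp
    have P4: "(i, j) \<in> edges (Pn 4) \<longleftrightarrow> i < 4 \<and> j < 4 \<and> (j = Suc i \<or> i = Suc j)" for i j
      by (simp add: Pn_def)
    have surj: "\<exists>x\<in>W. f x = i" if "i < 4" for i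
    proof -
      have "i \<in> f ` W" using bij_betw_imp_surj_on[OF f] that by simp
      then show ?thesis by (auto simp del: lessThan_iff)
    qed
    obtain a where a: "a \<in> W" "f a = 0" using surj[of 0] by auto
    obtain b where b: "b \<in> W" "f b = 1" using surj[of 1] by auto
    obtain c where c: "c \<in> W" "f c = 2" using surj[of 2] by auto
    obtain d where d: "d \<in> W" "f d = 3" using surj[of 3] by auto
    note abcd = a b c d
    have "distinct [a, b, c, d]" using abcd by auto
    then show ?thesis
      using abcd W(1) P4_freeD[of ?E "verts G" a b c d]
        adj[of a b] adj[of b c] adj[of c d] adj[of a c] adj[of a d] adj[of b d]
      by (auto simp: P4)
  qed
  moreover have "\<exists>W\<subseteq>verts G. induced G W \<cong> Pn 4" if "\<not> P4_free ?E (verts G)"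
  proof -
    obtain a b c d where abcd: "a \<in> verts G" "b \<in> verts G" "c \<in> verts G" "d \<in> verts G"
      and dist: "distinct [a, b, c, d]"
      and adj: "(a, b) \<in> ?E" "(b, c) \<in> ?E" "(c, d) \<in> ?E" "(a, c) \<notin> ?E" "(a, d) \<notin> ?E" "(b, d) \<notin> ?E"
      using \<open>\<not> P4_free ?E (verts G)\<close> unfolding P4_free_def by blast
    have adj': "(b, a) \<in> ?E" "(c, b) \<in> ?E" "(d, c) \<in> ?E" "(c, a) \<notin> ?E" "(d, a) \<notin> ?E" "(d, b) \<notin> ?E"
      using adj sym by blast+
    \<comment> \<open>Positions along the path; \<open>d\<close> receives the default value
      3.\<close>
    define f where "f = (\<lambda>_. 3 :: nat)(a := 0, b := 1, c := 2)"
    have f: "f a = 0" "f b = 1" "f c = 2" "f d = 3" using dist by (auto simp: f_def)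
    have "bij_betw f {a, b, c, d} {..<4}"
      unfolding bij_betw_def lt4 using f by (auto simp: inj_on_def)
    moreover have "(u, v) \<in> edges (induced G {a, b, c, d}) \<longleftrightarrow> (f u, f v) \<in> edges (Pn 4)"
      if "u \<in> {a, b, c, d}" "v \<in> {a, b, c, d}" for u v
      using that adj adj' irrefl by (auto simp: f Pn_def)
    ultimately have "induced G {a, b, c, d} \<cong> Pn 4"
      unfolding isomorphic_def by (intro exI[of _ f]) (auto simp: Pn_def)
    then show ?thesis using abcd by (intro exI[of _ "{a, b, c, d}"]) simp
  qed
  ultimately show ?thesis using assms unfolding cograph_def by blast
qed

lemma obstruction_iff:
  assumes "simple_graph G"
  shows "cograph_minimal_polar_obstruction \<infinity> 2 G \<longleftrightarrow>
    (\<exists>t\<in>set obstruction_trees. realizes t (edges G) (verts G))"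
proof -
  let ?E = "edges G" and ?V = "verts G"
  have fin: "finite ?V" and sym: "sym ?E" and irrefl: "irrefl ?E"
    using assms by (auto simp: simple_graph_def)
  have G: "induced G ?V = G"
    using assms by (cases G) (auto simp: induced_def simple_graph_def)
  have "(\<forall>W\<subset>?V. polar \<infinity> 2 (induced G W)) \<longleftrightarrow> (\<forall>x\<in>?V. splits Multi ?E (?V - {x}) 2)"
    unfolding polar_iff_splits[OF assms]
  proof (intro iffI ballI allI impI)
    fix W
    assume *: "\<forall>x\<in>?V. splits Multi ?E (?V - {x}) 2" "W \<subset> ?V"
    then obtain x where x: "x \<in> ?V" "W \<subseteq> ?V - {x}" by blast
    then have "splits Multi ?E (?V - {x}) 2" using *(1) by blast
    then show "splits Multi ?E W 2" by (rule splits_mono) (use x fin in auto)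
  qed blast
  then have "cograph_minimal_polar_obstruction \<infinity> 2 G \<longleftrightarrow> P4_free ?E ?V \<and> polar_obstruction ?E ?V"
    unfolding cograph_minimal_polar_obstruction_def polar_obstruction_def
      cograph_iff_P4_free[OF assms] polar_iff_splits[OF assms, of ?V, unfolded G] by blast
  also have "\<dots> \<longleftrightarrow> (\<exists>t\<in>set obstruction_trees. realizes t ?E ?V)"
    using obstruction_realized[OF fin sym irrefl] obstruction_trees_obstruct realizes_P4_free by blast
  finally show ?thesis .
qed

section \<open>Cotrees of graphs\<close>

definition has_cotree :: "cotree \<Rightarrow> 'a sgraph \<Rightarrow> bool" where
  "has_cotree t G \<longleftrightarrow> realizes t (edges G) (verts G)"

text \<open>Stated for embeddings of \<open>W\<close>, so it serves both isomorphisms and the even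
  and odd relabellings in unions and joins.\<close>

lemma realizes_image:
  assumes "realizes t E W" "inj_on f W"
    and "\<And>u v. u \<in> W \<Longrightarrow> v \<in> W \<Longrightarrow> (u, v) \<in> E \<longleftrightarrow> (f u, f v) \<in> E'"
  shows "realizes t E' (f ` W)"
  using assms
proof (induction t arbitrary: W)
  case Leaf
  then show ?case by auto
next
  case (Node b s t)
  obtain U V where UV: "W = U \<union> V" "cross E b U V" "realizes s E U" "realizes t E V"
    using Node.prems(1) by (rule realizes_NodeE)
  have "inj_on f U" "inj_on f V" using Node.prems(2) UV(1) by (auto simp: inj_on_Un)
  then have "realizes s E' (f ` U)" "realizes t E' (f ` V)"
    using Node.IH(1)[OF UV(3)] Node.IH(2)[OF UV(4)] Node.prems(3) UV(1) by auto
  moreover have "cross E' b (f ` U) (f ` V)"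
    unfolding cross_def
  proof (intro conjI ballI)
    show "f ` U \<inter> f ` V = {}"
      using Node.prems(2) UV(1,2) by (auto simp: cross_def inj_on_def)
    fix x y
    assume "x \<in> f ` U" "y \<in> f ` V"
    then obtain u v where uv: "u \<in> U" "v \<in> V" "x = f u" "y = f v" by blast
    then have "u \<in> W" "v \<in> W" "((u, v) \<in> E) = b" "((v, u) \<in> E) = b"
      using UV(1,2) by (simp_all add: cross_def)
    then show "((x, y) \<in> E') = b" "((y, x) \<in> E') = b"
      using Node.prems(3)[of u v] Node.prems(3)[of v u] uv by simp_all
  qed
  ultimately show ?case unfolding UV(1) image_Un by (intro realizes_NodeI)
qed

lemma isomorphic_has_cotree:
  assumes "G \<cong> H"
  shows "has_cotree t G \<longleftrightarrow> has_cotree t H"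
proof -
  obtain f where f: "bij_betw f (verts G) (verts H)"
    and adj: "\<forall>u\<in>verts G. \<forall>v\<in>verts G. (u, v) \<in> edges G \<longleftrightarrow> (f u, f v) \<in> edges H"
    using assms unfolding isomorphic_def by (elim exE conjE) (rule that)
  let ?g = "inv_into (verts G) f"
  have fV: "f ` verts G = verts H" using f by (rule bij_betw_imp_surj_on)
  have g: "bij_betw ?g (verts H) (verts G)" using f by (rule bij_betw_inv_into)
  have g_adj: "(u, v) \<in> edges H \<longleftrightarrow> (?g u, ?g v) \<in> edges G" if "u \<in> verts H" "v \<in> verts H" for u v
  proof -
    have "?g u \<in> verts G" "?g v \<in> verts G" "f (?g u) = u" "f (?g v) = v"
      using that fV by (auto simp: inv_into_into f_inv_into_f)
    then show ?thesis using adj by simp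
  qed
  show ?thesis
    using realizes_image[of t "edges G" "verts G" f "edges H"] adj f fV
      realizes_image[of t "edges H" "verts H" ?g "edges G"] g_adj g
    unfolding has_cotree_def by (auto simp: bij_betw_def)
qed

text \<open>A cotree determines its graph up to isomorphism: isomorphisms of the operands glue
  together, as adjacency across is dictated by the label.\<close>

lemma realizes_isomorphic:
  assumes "realizes t E W" "realizes t E' W'"
  shows "\<exists>f. bij_betw f W W' \<and> (\<forall>u\<in>W. \<forall>v\<in>W. (u, v) \<in> E \<longleftrightarrow> (f u, f v) \<in> E')"
  using assms
proof (induction t arbitrary: W W')
  case Leaf
  then obtain x y where "W = {x}" "(x, x) \<notin> E" "W' = {y}" "(y, y) \<notin> E'" by auto
  then show ?case by (intro exI[of _ "\<lambda>_. y"]) (auto simp: bij_betw_def)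
next
  case (Node b s t)
  obtain U V where UV: "W = U \<union> V" "cross E b U V" "realizes s E U" "realizes t E V"
    using Node.prems(1) by (rule realizes_NodeE)
  obtain U' V' where UV': "W' = U' \<union> V'" "cross E' b U' V'" "realizes s E' U'" "realizes t E' V'"
    using Node.prems(2) by (rule realizes_NodeE)
  obtain f where f: "bij_betw f U U'" "\<forall>u\<in>U. \<forall>v\<in>U. (u, v) \<in> E \<longleftrightarrow> (f u, f v) \<in> E'"
    using Node.IH(1)[OF UV(3) UV'(3)] by (elim exE conjE) (rule that)
  obtain g where g: "bij_betw g V V'" "\<forall>u\<in>V. \<forall>v\<in>V. (u, v) \<in> E \<longleftrightarrow> (g u, g v) \<in> E'"
    using Node.IH(2)[OF UV(4) UV'(4)] by (elim exE conjE) (rule that)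
  define h where "h x = (if x \<in> U then f x else g x)" for x
  have hU: "h x = f x" "f x \<in> U'" if "x \<in> U" for x
    using that f(1) by (auto simp: h_def bij_betw_def)
  have hV: "h x = g x" "g x \<in> V'" if "x \<in> V" for x
    using that g(1) UV(2) by (auto simp: h_def bij_betw_def cross_def)
  have "bij_betw h U U'" "bij_betw h V V'"
    using f(1) g(1) hU(1) hV(1) by (simp_all cong: bij_betw_cong)
  then have "bij_betw h (U \<union> V) (U' \<union> V')"
    using UV'(2) by (intro bij_betw_combine) (simp_all add: cross_def)
  moreover have "(u, v) \<in> E \<longleftrightarrow> (h u, h v) \<in> E'" if uv: "u \<in> U \<union> V" "v \<in> U \<union> V" for u v
  proof -
    consider "u \<in> U" "v \<in> U" | "u \<in> V" "v \<in> V" | "u \<in> U" "v \<in> V" | "u \<in> V" "v \<in> U" using uv by blast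
    then show ?thesis
    proof cases
      case 1
      then show ?thesis using f(2) by (simp add: hU)
    next
      case 2
      then show ?thesis using g(2) by (simp add: hV)
    next
      case 3
      then show ?thesis using UV(2) UV'(2) hU(2)[of u] hV(2)[of v] by (simp add: hU hV cross_def)
    next
      case 4
      then show ?thesis using UV(2) UV'(2) hU(2)[of v] hV(2)[of u] by (simp add: hU hV cross_def)
    qed
  qed
  ultimately show ?case unfolding UV(1) UV'(1) by (intro exI[of _ h]) simp
qed

lemma has_cotree_isomorphic: "has_cotree t G \<Longrightarrow> has_cotree t H \<Longrightarrow> G \<cong> H"
  unfolding has_cotree_def isomorphic_def by (rule realizes_isomorphic)

text \<open>Turns isomorphism with a listed graph into membership of a tree in a list, which can be
  evaluated. Backwards, \<open>G\<close> and \<open>H\<close> realize the same normal form and are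
  therefore isomorphic.\<close>

lemma isomorphic_normal_form:
  assumes "list_all2 has_cotree ts Hs"
  shows "(\<exists>H\<in>set Hs. G \<cong> H) \<longleftrightarrow> (\<exists>t\<in>set (map cotree_nf ts). has_cotree t G)"
proof
  assume "\<exists>H\<in>set Hs. G \<cong> H"
  then obtain H where H: "H \<in> set Hs" "G \<cong> H" by blast
  then obtain t where t: "t \<in> set ts" "has_cotree t H"
    using assms by (metis in_set_conv_nth list_all2_conv_all_nth)
  then have "has_cotree t G" using isomorphic_has_cotree[OF H(2)] by blast
  then have "has_cotree (cotree_nf t) G" by (simp add: has_cotree_def realizes_cotree_nf)
  then show "\<exists>t\<in>set (map cotree_nf ts). has_cotree t G" using t by auto
next
  assume "\<exists>t\<in>set (map cotree_nf ts). has_cotree t G"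
  then obtain t where t: "t \<in> set ts" "has_cotree (cotree_nf t) G" by auto
  then obtain H where H: "H \<in> set Hs" "has_cotree t H"
    using assms by (metis in_set_conv_nth list_all2_conv_all_nth)
  then have "has_cotree (cotree_nf t) H" by (simp add: has_cotree_def realizes_cotree_nf)
  then show "\<exists>H\<in>set Hs. G \<cong> H" using t H has_cotree_isomorphic by blast
qed

section \<open>Cotrees of unions, joins, copies and complements\<close>

lemma verts_disjoint_union: "verts (G \<uplus> H) = (\<lambda>u. 2 * u) ` verts G \<union> (\<lambda>u. 2 * u + 1) ` verts H"
  and edges_disjoint_union:
    "(2 * u, 2 * v) \<in> edges (G \<uplus> H) \<longleftrightarrow> (u, v) \<in> edges G"
    "(2 * u + 1, 2 * v + 1) \<in> edges (G \<uplus> H) \<longleftrightarrow> (u, v) \<in> edges H"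
    "(2 * u, 2 * v + 1) \<notin> edges (G \<uplus> H)" "(2 * u + 1, 2 * v) \<notin> edges (G \<uplus> H)"
proof -
  have odd: "2 * i \<noteq> Suc (2 * j)" "Suc (2 * j) \<noteq> 2 * i" for i j :: nat by presburger+
  show "verts (G \<uplus> H) = (\<lambda>u. 2 * u) ` verts G \<union> (\<lambda>u. 2 * u + 1) ` verts H"
    by (simp add: disjoint_union_def)
  show "(2 * u, 2 * v) \<in> edges (G \<uplus> H) \<longleftrightarrow> (u, v) \<in> edges G"
    "(2 * u + 1, 2 * v + 1) \<in> edges (G \<uplus> H) \<longleftrightarrow> (u, v) \<in> edges H"
    "(2 * u, 2 * v + 1) \<notin> edges (G \<uplus> H)" "(2 * u + 1, 2 * v) \<notin> edges (G \<uplus> H)"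
    by (force simp: disjoint_union_def odd)+
qed

lemma verts_join: "verts (G \<oplus> H) = verts (G \<uplus> H)"
  and edges_join:
    "(2 * u, 2 * v) \<in> edges (G \<oplus> H) \<longleftrightarrow> (u, v) \<in> edges G"
    "(2 * u + 1, 2 * v + 1) \<in> edges (G \<oplus> H) \<longleftrightarrow> (u, v) \<in> edges H"
    "u \<in> verts G \<Longrightarrow> v \<in> verts H \<Longrightarrow> (2 * u, 2 * v + 1) \<in> edges (G \<oplus> H)"
    "u \<in> verts H \<Longrightarrow> v \<in> verts G \<Longrightarrow> (2 * u + 1, 2 * v) \<in> edges (G \<oplus> H)"
proof -
  have odd: "2 * i \<noteq> Suc (2 * j)" "Suc (2 * j) \<noteq> 2 * i" for i j :: nat by presburger+
  show "verts (G \<oplus> H) = verts (G \<uplus> H)" by (simp add: join_def Let_def)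
  show "(2 * u, 2 * v) \<in> edges (G \<oplus> H) \<longleftrightarrow> (u, v) \<in> edges G"
    "(2 * u + 1, 2 * v + 1) \<in> edges (G \<oplus> H) \<longleftrightarrow> (u, v) \<in> edges H"
    using edges_disjoint_union[of u v G H] by (auto simp: join_def Let_def odd)
  show "(2 * u, 2 * v + 1) \<in> edges (G \<oplus> H)" if "u \<in> verts G" "v \<in> verts H"
    using that by (simp add: join_def Let_def)
  show "(2 * u + 1, 2 * v) \<in> edges (G \<oplus> H)" if "u \<in> verts H" "v \<in> verts G"
    using that by (simp add: join_def Let_def)
qed

lemma has_cotree_disjoint_union:
  assumes "has_cotree s G" "has_cotree t H"
  shows "has_cotree (Par s t) (G \<uplus> H)"
proof -
  let ?E = "edges (G \<uplus> H)"
  have odd: "2 * i \<noteq> Suc (2 * j)" for i j :: nat by presburger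
  have "realizes s ?E ((\<lambda>u. 2 * u) ` verts G)"
    using assms(1) unfolding has_cotree_def
    by (rule realizes_image) (simp_all only: edges_disjoint_union, simp add: inj_on_def)
  moreover have "realizes t ?E ((\<lambda>u. 2 * u + 1) ` verts H)"
    using assms(2) unfolding has_cotree_def
    by (rule realizes_image) (simp_all only: edges_disjoint_union, simp add: inj_on_def)
  moreover have "cross ?E False ((\<lambda>u. 2 * u) ` verts G) ((\<lambda>u. 2 * u + 1) ` verts H)"
    unfolding cross_def using odd by (auto simp: edges_disjoint_union[simplified])
  ultimately show ?thesis
    unfolding has_cotree_def verts_disjoint_union by (intro realizes_NodeI)
qed

lemma has_cotree_join:
  assumes "has_cotree s G" "has_cotree t H"
  shows "has_cotree (Ser s t) (G \<oplus> H)"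
proof -
  let ?E = "edges (G \<oplus> H)"
  have odd: "2 * i \<noteq> Suc (2 * j)" for i j :: nat by presburger
  have "realizes s ?E ((\<lambda>u. 2 * u) ` verts G)"
    using assms(1) unfolding has_cotree_def
    by (rule realizes_image) (simp_all only: edges_join, simp add: inj_on_def)
  moreover have "realizes t ?E ((\<lambda>u. 2 * u + 1) ` verts H)"
    using assms(2) unfolding has_cotree_def
    by (rule realizes_image) (simp_all only: edges_join, simp add: inj_on_def)
  moreover have "cross ?E True ((\<lambda>u. 2 * u) ` verts G) ((\<lambda>u. 2 * u + 1) ` verts H)"
    unfolding cross_def using odd by (auto simp: edges_join[simplified])
  ultimately show ?thesis
    unfolding has_cotree_def verts_join verts_disjoint_union by (intro realizes_NodeI)
qed

text \<open>\<open>copies\<close> ends in the empty graph, which has no cotree, so this operand has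
  to be absorbed separately; the same happens for \<open>0 \<cdot> Kn 2\<close> in the
  lists.\<close>

lemma has_cotree_disjoint_union_empty:
  assumes "has_cotree t G"
  shows "has_cotree t (G \<uplus> 0 \<cdot> H)"
proof -
  have "realizes t (edges (G \<uplus> 0 \<cdot> H)) ((\<lambda>u. 2 * u) ` verts G)"
    using assms unfolding has_cotree_def
    by (rule realizes_image) (simp_all only: edges_disjoint_union, simp add: inj_on_def)
  then show ?thesis by (simp add: has_cotree_def disjoint_union_def)
qed

lemma has_cotree_copies:
  assumes "has_cotree t G"
  shows "has_cotree t (1 \<cdot> G)" "has_cotree (Par t t) (2 \<cdot> G)" "has_cotree (Par t (Par t t)) (3 \<cdot> G)"
proof -
  show 1: "has_cotree t (1 \<cdot> G)"
    using has_cotree_disjoint_union_empty[OF assms, of G] by simp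
  show 2: "has_cotree (Par t t) (2 \<cdot> G)"
    using has_cotree_disjoint_union[OF assms 1] by (simp add: numeral_2_eq_2)
  show "has_cotree (Par t (Par t t)) (3 \<cdot> G)"
    using has_cotree_disjoint_union[OF assms 2] by (simp add: numeral_3_eq_3 numeral_2_eq_2)
qed

text \<open>Complementation exchanges union and join, hence flips every label.\<close>

primrec dual :: "cotree \<Rightarrow> cotree" where
  "dual Leaf = Leaf"
| "dual (Node b s t) = Node (\<not> b) (dual s) (dual t)"

lemma realizes_dual:
  assumes "realizes t E W" "\<And>u v. u \<in> W \<Longrightarrow> v \<in> W \<Longrightarrow> (u, v) \<in> E' \<longleftrightarrow> u \<noteq> v \<and> (u, v) \<notin> E"
  shows "realizes (dual t) E' W"
  using assms
proof (induction t arbitrary: W)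
  case Leaf
  then show ?case by auto
next
  case (Node b s t)
  obtain U V where UV: "W = U \<union> V" "cross E b U V" "realizes s E U" "realizes t E V"
    using Node.prems(1) by (rule realizes_NodeE)
  have "realizes (dual s) E' U" "realizes (dual t) E' V"
    using Node.IH(1)[OF UV(3)] Node.IH(2)[OF UV(4)] Node.prems(2) UV(1) by auto
  moreover have "cross E' (\<not> b) U V"
    unfolding cross_def
  proof (intro conjI ballI)
    show disj: "U \<inter> V = {}" using UV(2) by (simp add: cross_def)
    fix u v
    assume uv: "u \<in> U" "v \<in> V"
    then have "u \<noteq> v" using disj by blast
    then show "((u, v) \<in> E') = (\<not> b)" "((v, u) \<in> E') = (\<not> b)"
      using uv UV(1,2) Node.prems(2)[of u v] Node.prems(2)[of v u] by (simp_all add: cross_def)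
  qed
  ultimately show ?case unfolding UV(1) dual.simps by (intro realizes_NodeI)
qed

lemma has_cotree_complement: "has_cotree t G \<Longrightarrow> has_cotree (dual t) (complement G)"
  unfolding has_cotree_def by (auto simp: complement_def intro: realizes_dual)

lemma dual_dual [simp]: "dual (dual t) = t"
  by (induction t) auto

lemma has_cotree_complement_iff:
  assumes "simple_graph G"
  shows "has_cotree t (complement G) \<longleftrightarrow> has_cotree (dual t) G"
proof -
  have "complement (complement G) = G"
    using assms by (cases G) (auto simp: complement_def simple_graph_def irrefl_def)
  then show ?thesis
    using has_cotree_complement[of t "complement G"] has_cotree_complement[of "dual t" G] by auto
qed

section \<open>Invariants read off a cotree\<close>

text \<open>Operands of a cotree are nonempty, so a join is connected and, likewise in
  \<open>num_isolated\<close>, has no isolated vertex.\<close>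

primrec num_components :: "cotree \<Rightarrow> nat" where
  "num_components Leaf = 1"
| "num_components (Node b s t) = (if b then 1 else num_components s + num_components t)"

primrec num_isolated :: "cotree \<Rightarrow> nat" where
  "num_isolated Leaf = 1"
| "num_isolated (Node b s t) = (if b then 0 else num_isolated s + num_isolated t)"

primrec degrees :: "cotree \<Rightarrow> nat list" where
  "degrees Leaf = [0]"
| "degrees (Node b s t) =
     map (\<lambda>d. if b then d + leaves t else d) (degrees s) @
     map (\<lambda>d. if b then d + leaves s else d) (degrees t)"

text \<open>Components relative to a subset of a fixed \<open>E\<close>, in the form required for
  induction over a cotree; \<open>components_comps\<close> links it to
  \<open>components\<close>.\<close>

definition comps :: "'a rel \<Rightarrow> 'a set \<Rightarrow> 'a set set" where
  "comps E W = (\<lambda>u. {v \<in> W. (u, v) \<in> (E \<inter> W \<times> W)\<^sup>*}) ` W"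

lemma comps_Un_no_edges:
  assumes "cross E False U V"
  shows "comps E (U \<union> V) = comps E U \<union> comps E V"
proof -
  have *: "{v \<in> U \<union> V. (u, v) \<in> (E \<inter> (U \<union> V) \<times> (U \<union> V))\<^sup>*} = {v \<in> U. (u, v) \<in> (E \<inter> U \<times> U)\<^sup>*}"
    if "cross E False U V" "u \<in> U" for U V :: "'a set" and u
  proof -
    have "v \<in> U \<and> (u, v) \<in> (E \<inter> U \<times> U)\<^sup>*" if "(u, v) \<in> (E \<inter> (U \<union> V) \<times> (U \<union> V))\<^sup>*" for v
      using that
    proof (induction rule: rtrancl_induct)
      case base
      then show ?case using \<open>u \<in> U\<close> by simp
    next
      case (step v w)
      then have "(v, w) \<in> E \<inter> U \<times> U" using \<open>cross E False U V\<close> by (auto simp: cross_def)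
      then show ?case using step by (meson IntD2 SigmaD2 rtrancl.rtrancl_into_rtrancl)
    qed
    moreover have "(E \<inter> U \<times> U)\<^sup>* \<subseteq> (E \<inter> (U \<union> V) \<times> (U \<union> V))\<^sup>*" by (rule rtrancl_mono) blast
    ultimately show ?thesis by blast
  qed
  have "cross E False V U" using assms by (simp add: cross_commute[of E False V U])
  then show ?thesis
    unfolding comps_def image_Un
    using *[OF assms] *[of V U] by (intro arg_cong2[of _ _ _ _ "(\<union>)"] image_cong) (simp_all add: Un_commute)
qed

text \<open>Vertices on the same side are linked through a vertex across; everything reaches the
  fixed \<open>x\<close> and is reached from it.\<close>

lemma comps_Un_all_edges:
  assumes "cross E True U V" "U \<noteq> {}" "V \<noteq> {}"
  shows "comps E (U \<union> V) = {U \<union> V}"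
proof -
  let ?R = "E \<inter> (U \<union> V) \<times> (U \<union> V)"
  obtain x y where xy: "x \<in> U" "y \<in> V" using assms by blast
  have edge: "(u, v) \<in> ?R" "(v, u) \<in> ?R" if "u \<in> U" "v \<in> V" for u v
    using assms(1) that by (auto simp: cross_def)
  have x: "(u, x) \<in> ?R\<^sup>* \<and> (x, u) \<in> ?R\<^sup>*" if "u \<in> U \<union> V" for u
  proof (cases "u \<in> U")
    case True
    then show ?thesis using edge[of u y] edge[of x y] xy by (meson r_into_rtrancl rtrancl_trans)
  next
    case False
    then show ?thesis using edge[of x u] xy that by auto
  qed
  have "(u, v) \<in> ?R\<^sup>*" if "u \<in> U \<union> V" "v \<in> U \<union> V" for u v
    using x[OF that(1)] x[OF that(2)] by (meson rtrancl_trans)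
  then have "{v \<in> U \<union> V. (u, v) \<in> ?R\<^sup>*} = U \<union> V" if "u \<in> U \<union> V" for u
    using that by blast
  then have "comps E (U \<union> V) = (\<lambda>_. U \<union> V) ` (U \<union> V)"
    unfolding comps_def by (intro image_cong) simp_all
  then show ?thesis using xy by auto
qed

lemma card_comps: "realizes t E W \<Longrightarrow> card (comps E W) = num_components t"
proof (induction t arbitrary: W)
  case Leaf
  then show ?case by (auto simp: comps_def)
next
  case (Node b s t)
  obtain U V where UV: "W = U \<union> V" "cross E b U V" "realizes s E U" "realizes t E V"
    using Node.prems(1) by (rule realizes_NodeE)
  have fin: "finite U" "finite V" and ne: "U \<noteq> {}" "V \<noteq> {}"
    using UV realizes_finite realizes_nonempty by blast+
  show ?case
  proof (cases b)
    case True
    then show ?thesis using UV ne comps_Un_all_edges[of E U V] by simp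
  next
    case False
    have "X \<noteq> {} \<and> X \<subseteq> U" if "X \<in> comps E U" for X U using that by (auto simp: comps_def)
    then have "comps E U \<inter> comps E V = {}" using UV(2) unfolding cross_def by blast
    moreover have "finite (comps E U)" "finite (comps E V)" using fin by (simp_all add: comps_def)
    ultimately show ?thesis
      using False UV Node.IH comps_Un_no_edges[of E U V] by (simp add: card_Un_disjoint)
  qed
qed

lemma card_isolated:
  "realizes t E W \<Longrightarrow> card {v \<in> W. \<forall>u\<in>W. (v, u) \<notin> E} = num_isolated t"
proof (induction t arbitrary: W)
  case Leaf
  then obtain x where "W = {x}" "(x, x) \<notin> E" by auto
  then have "{v \<in> W. \<forall>u\<in>W. (v, u) \<notin> E} = {x}" by auto
  then show ?case by simp
next
  case (Node b s t)
  obtain U V where UV: "W = U \<union> V" "cross E b U V" "realizes s E U" "realizes t E V"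
    using Node.prems(1) by (rule realizes_NodeE)
  have fin: "finite U" "finite V" and ne: "U \<noteq> {}" "V \<noteq> {}"
    using UV realizes_finite realizes_nonempty by blast+
  have adj: "((u, v) \<in> E) = b" "((v, u) \<in> E) = b" if "u \<in> U" "v \<in> V" for u v
    using UV(2) that by (simp_all add: cross_def)
  show ?case
  proof (cases b)
    case True
    then have "{v \<in> W. \<forall>u\<in>W. (v, u) \<notin> E} = {}" using UV(1) ne adj by blast
    then have "card {v \<in> W. \<forall>u\<in>W. (v, u) \<notin> E} = 0" by (simp only: card.empty)
    then show ?thesis using True by simp
  next
    case False
    then have "{v \<in> W. \<forall>u\<in>W. (v, u) \<notin> E} =
        {v \<in> U. \<forall>u\<in>U. (v, u) \<notin> E} \<union> {v \<in> V. \<forall>u\<in>V. (v, u) \<notin> E}"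
      using UV(1) adj by blast
    moreover have "{v \<in> U. \<forall>u\<in>U. (v, u) \<notin> E} \<inter> {v \<in> V. \<forall>u\<in>V. (v, u) \<notin> E} = {}"
      using UV(2) unfolding cross_def by blast
    ultimately show ?thesis
      using False fin UV Node.IH by (simp add: card_Un_disjoint)
  qed
qed

lemma card_realizes: "realizes t E W \<Longrightarrow> card W = leaves t"
proof (induction t arbitrary: W)
  case (Node b s t)
  obtain U V where UV: "W = U \<union> V" "cross E b U V" "realizes s E U" "realizes t E V"
    using Node.prems(1) by (rule realizes_NodeE)
  then show ?case
    using Node.IH realizes_finite[OF UV(3)] realizes_finite[OF UV(4)]
    by (simp add: cross_def card_Un_disjoint)
qed auto

section \<open>Degree codes as isomorphism invariants\<close>

definition degree :: "'a rel \<Rightarrow> 'a set \<Rightarrow> 'a \<Rightarrow> nat" where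
  "degree E W v = card {u \<in> W. (v, u) \<in> E}"

lemma degree_Un:
  assumes "cross E b U V" "finite U" "finite V" "v \<in> U"
  shows "degree E (U \<union> V) v = (if b then degree E U v + card V else degree E U v)"
proof -
  have V: "{u \<in> V. (v, u) \<in> E} = (if b then V else {})"
    using assms(1,4) by (auto simp: cross_def)
  have "{u \<in> U \<union> V. (v, u) \<in> E} = {u \<in> U. (v, u) \<in> E} \<union> {u \<in> V. (v, u) \<in> E}" by blast
  moreover have "{u \<in> U. (v, u) \<in> E} \<inter> {u \<in> V. (v, u) \<in> E} = {}"
    using assms(1) unfolding cross_def by blast
  ultimately have "degree E (U \<union> V) v = degree E U v + card {u \<in> V. (v, u) \<in> E}"
    unfolding degree_def using assms(2,3) by (simp add: card_Un_disjoint)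
  then show ?thesis unfolding V by simp
qed

text \<open>The induction needs an arbitrary \<open>f\<close>: a join shifts the degrees on one side
  by the size of the other, and the shift is absorbed into \<open>f\<close>.\<close>

lemma sum_degrees:
  fixes f :: "nat \<Rightarrow> nat"
  shows "realizes t E W \<Longrightarrow> (\<Sum>v\<in>W. f (degree E W v)) = sum_list (map f (degrees t))"
proof (induction t arbitrary: W f)
  case Leaf
  then show ?case by (auto simp: degree_def cong: conj_cong)
next
  case (Node b s t)
  obtain U V where UV: "W = U \<union> V" "cross E b U V" "realizes s E U" "realizes t E V"
    using Node.prems(1) by (rule realizes_NodeE)
  have fin: "finite U" "finite V" using UV realizes_finite by blast+
  have card: "card U = leaves s" "card V = leaves t" using UV card_realizes by blast+
  have disj: "U \<inter> V = {}" using UV(2) by (simp add: cross_def)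
  have U: "degree E W v = (if b then degree E U v + leaves t else degree E U v)" if "v \<in> U" for v
    using degree_Un[OF UV(2) fin that] by (simp add: UV(1) card)
  have V: "degree E W v = (if b then degree E V v + leaves s else degree E V v)" if "v \<in> V" for v
    using degree_Un[of E b V U v] UV(2) fin that
    by (simp add: UV(1) card Un_commute[of U V] cross_commute[of E b V U])
  have "(\<Sum>v\<in>W. f (degree E W v)) = (\<Sum>v\<in>U. f (degree E W v)) + (\<Sum>v\<in>V. f (degree E W v))"
    unfolding UV(1) using fin disj by (rule sum.union_disjoint)
  also have "(\<Sum>v\<in>U. f (degree E W v)) =
      (\<Sum>v\<in>U. (\<lambda>d. f (if b then d + leaves t else d)) (degree E U v))"
    by (intro sum.cong) (simp_all add: U)
  also have "(\<Sum>v\<in>V. f (degree E W v)) =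
      (\<Sum>v\<in>V. (\<lambda>d. f (if b then d + leaves s else d)) (degree E V v))"
    by (intro sum.cong) (simp_all add: V)
  finally show ?case
    using Node.IH(1)[OF UV(3), of "\<lambda>d. f (if b then d + leaves t else d)"]
      Node.IH(2)[OF UV(4), of "\<lambda>d. f (if b then d + leaves s else d)"] by (simp add: comp_def)
qed

text \<open>The base 5 is the least one for which this number separates the 23 obstructions.\<close>

definition degree_code :: "'a sgraph \<Rightarrow> nat" where
  "degree_code G = (\<Sum>v\<in>verts G. 5 ^ degree (edges G) (verts G) v)"

definition cotree_degree_code :: "cotree \<Rightarrow> nat" where
  "cotree_degree_code t = sum_list (map (\<lambda>d. 5 ^ d) (degrees t))"

lemma has_cotree_degree_code: "has_cotree t G \<Longrightarrow> degree_code G = cotree_degree_code t"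
  unfolding has_cotree_def degree_code_def cotree_degree_code_def by (rule sum_degrees)

lemma components_comps:
  assumes "simple_graph G"
  shows "components G = comps (edges G) (verts G)"
proof -
  have "edges G \<inter> verts G \<times> verts G = edges G" using assms by (auto simp: simple_graph_def)
  then show ?thesis by (simp add: components_eq comps_def)
qed

lemma card_components:
  "simple_graph G \<Longrightarrow> has_cotree t G \<Longrightarrow> card (components G) = num_components t"
  by (simp add: components_comps has_cotree_def card_comps)

lemma card_isolated_verts: "has_cotree t G \<Longrightarrow> card (isolated_verts G) = num_isolated t"
  by (simp add: isolated_verts_def has_cotree_def card_isolated)

lemma isolated_verts_empty_iff:
  assumes "has_cotree t G"
  shows "isolated_verts G = {} \<longleftrightarrow> num_isolated t = 0"
proof -
  have "finite (isolated_verts G)"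
    using assms realizes_finite[of t "edges G" "verts G"]
    by (simp add: isolated_verts_def has_cotree_def)
  then show ?thesis using card_isolated_verts[OF assms] by (metis card_0_eq)
qed

lemma connected_graph_iff:
  assumes "simple_graph G" "has_cotree t G"
  shows "connected_graph G \<longleftrightarrow> num_components t = 1"
proof -
  let ?C = "\<lambda>u. {v \<in> verts G. (u, v) \<in> (edges G)\<^sup>*}"
  have fin: "finite (verts G)" and ne: "verts G \<noteq> {}"
    using assms(2) realizes_finite realizes_nonempty unfolding has_cotree_def by blast+
  have "card (components G) = 1 \<longleftrightarrow> connected_graph G"
  proof
    assume "card (components G) = 1"
    then obtain X where X: "components G = {X}" by (rule card_1_singletonE)
    have "(u, v) \<in> (edges G)\<^sup>*" if "u \<in> verts G" "v \<in> verts G" for u v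
    proof -
      have "?C u \<in> components G" "?C v \<in> components G" using that by (auto simp: components_eq)
      then have "?C u = ?C v" using X by simp
      moreover have "v \<in> ?C v" using that by simp
      ultimately have "v \<in> ?C u" by simp
      then show ?thesis by simp
    qed
    then show "connected_graph G" using ne by (simp add: connected_graph_def)
  next
    assume "connected_graph G"
    then have "?C u = verts G" if "u \<in> verts G" for u
      using that unfolding connected_graph_def by blast
    then have "components G = (\<lambda>_. verts G) ` verts G"
      unfolding components_eq by (intro image_cong) simp_all
    then show "card (components G) = 1" using ne by (simp add: image_constant_conv)
  qed
  then show ?thesis using card_components[OF assms] by simp
qed

section \<open>The listed graphs\<close>

abbreviation (input) "K2_tree \<equiv> Ser Leaf Leaf"
abbreviation (input) "P3_tree \<equiv> Ser Leaf (Par Leaf Leaf)"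
abbreviation (input) "C4_tree \<equiv> Ser (Par Leaf Leaf) (Par Leaf Leaf)"

lemma has_cotree_K1: "has_cotree Leaf (Kn 1)"
  by (auto simp: has_cotree_def Kn_def)

lemma has_cotree_K2: "has_cotree K2_tree (Kn 2)"
proof -
  have "realizes K2_tree (edges (Kn 2)) ({0} \<union> {1})"
    by (intro realizes_NodeI) (auto simp: cross_def Kn_def)
  moreover have "{0} \<union> {1} = verts (Kn 2)" by (auto simp: Kn_def)
  ultimately show ?thesis unfolding has_cotree_def by argo
qed

lemma has_cotree_P3: "has_cotree P3_tree (Pn 3)"
proof -
  have "realizes P3_tree (edges (Pn 3)) ({1} \<union> ({0} \<union> {2}))"
    by (intro realizes_NodeI) (auto simp: cross_def Pn_def)
  moreover have "{1} \<union> ({0} \<union> {2}) = verts (Pn 3)" by (auto simp: Pn_def)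
  ultimately show ?thesis unfolding has_cotree_def by argo
qed

lemma has_cotree_C4: "has_cotree C4_tree (Cn 4)"
proof -
  have "realizes C4_tree (edges (Cn 4)) (({0} \<union> {2}) \<union> ({1} \<union> {3}))"
    by (intro realizes_NodeI) (auto simp: cross_def Cn_def)
  moreover have "({0} \<union> {2}) \<union> ({1} \<union> {3}) = verts (Cn 4)" by (auto simp: Cn_def)
  ultimately show ?thesis unfolding has_cotree_def by argo
qed

lemma has_cotree_Kpp:
  "has_cotree K2_tree (Kpq 1 1)"
  "has_cotree C4_tree (Kpq 2 2)"
  "has_cotree (Ser (Par Leaf (Par Leaf Leaf)) (Par Leaf (Par Leaf Leaf))) (Kpq 3 3)"
proof -
  have "realizes K2_tree (edges (Kpq 1 1)) ({0} \<union> {1})"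
    by (intro realizes_NodeI) (auto simp: cross_def Kpq_def)
  moreover have "{0} \<union> {1} = verts (Kpq 1 1)" by (auto simp: Kpq_def)
  ultimately show "has_cotree K2_tree (Kpq 1 1)" unfolding has_cotree_def by argo
  have "realizes C4_tree (edges (Kpq 2 2)) (({0} \<union> {1}) \<union> ({2} \<union> {3}))"
    by (intro realizes_NodeI) (auto simp: cross_def Kpq_def)
  moreover have "({0} \<union> {1}) \<union> ({2} \<union> {3}) = verts (Kpq 2 2)" by (auto simp: Kpq_def)
  ultimately show "has_cotree C4_tree (Kpq 2 2)" unfolding has_cotree_def by argo
  have "realizes (Ser (Par Leaf (Par Leaf Leaf)) (Par Leaf (Par Leaf Leaf))) (edges (Kpq 3 3))
      (({0} \<union> ({1} \<union> {2})) \<union> ({3} \<union> ({4} \<union> {5})))"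
    by (intro realizes_NodeI) (auto simp: cross_def Kpq_def)
  moreover have "({0} \<union> ({1} \<union> {2})) \<union> ({3} \<union> ({4} \<union> {5})) = verts (Kpq 3 3)" by (auto simp: Kpq_def)
  ultimately show "has_cotree (Ser (Par Leaf (Par Leaf Leaf)) (Par Leaf (Par Leaf Leaf))) (Kpq 3 3)"
    unfolding has_cotree_def by argo
qed

lemmas has_cotree_intros =
  has_cotree_K1 has_cotree_K2 has_cotree_P3 has_cotree_C4 has_cotree_Kpp has_cotree_copies
  has_cotree_complement has_cotree_join has_cotree_disjoint_union_empty has_cotree_disjoint_union

text \<open>These tree lists copy the shape of the graph expressions, with \<open>dual\<close> for a
  complement, so that the rules \<open>has_cotree_intros\<close> match literally. They are not in
  normal form.\<close>

definition summand_trees :: "cotree list" where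
  "summand_trees =
     [Ser Leaf C4_tree, dual (Par P3_tree P3_tree), Ser K2_tree (Par K2_tree K2_tree),
      Ser Leaf (Par K2_tree P3_tree)]"

definition no_isolated_trees :: "cotree list" where
  "no_isolated_trees =
     [Par P3_tree C4_tree, Par P3_tree (Ser Leaf (Par K2_tree K2_tree)),
      Par (Par P3_tree P3_tree) K2_tree]"

definition four_components_trees :: "cotree list" where
  "four_components_trees =
     [Par (Par Leaf (Par Leaf Leaf)) (Ser Leaf C4_tree),
      Par (Par Leaf (Par K2_tree K2_tree)) K2_tree,
      Par (Par (Par Leaf Leaf) K2_tree) C4_tree,
      Par (Par Leaf (Par Leaf Leaf)) (Ser (Par Leaf (Par Leaf Leaf)) (Par Leaf (Par Leaf Leaf)))]"

definition three_components_trees :: "cotree list" where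
  "three_components_trees =
     [Par (Par Leaf Leaf) (dual (Par P3_tree P3_tree)),
      Par (Par Leaf Leaf) (Ser Leaf (Par P3_tree K2_tree)),
      Par (Par Leaf Leaf) (Ser K2_tree (Par K2_tree K2_tree)),
      Par (Par Leaf Leaf) (Ser Leaf (Par C4_tree Leaf)),
      Par (Par Leaf Leaf) (Ser Leaf (dual (Par P3_tree K2_tree))),
      Par (Par Leaf Leaf) (Ser (dual K2_tree) (Par P3_tree Leaf)),
      Par (Par Leaf K2_tree) (Ser (Par Leaf Leaf) (Par K2_tree Leaf)),
      Par (Par Leaf Leaf) (Ser (Par Leaf Leaf) (Par K2_tree (Par Leaf Leaf)))]"

definition two_components_trees :: "cotree list" where
  "two_components_trees =
     [Par Leaf (Ser Leaf (Par Leaf (Par K2_tree K2_tree))),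
      Par Leaf (Ser Leaf (Par (Par Leaf Leaf) C4_tree)),
      Par Leaf (Ser Leaf (Par P3_tree P3_tree)),
      Par Leaf (Ser Leaf (Par Leaf (dual (Par K2_tree P3_tree))))]"

definition connected_trees :: "cotree list" where
  "connected_trees = map (\<lambda>t. dual (Par P3_tree t)) summand_trees"

text \<open>Lists in place of sets fix an order that pairs each graph with its cotree. In the
  families over \<open>p\<close> all values are written out, including the empty
  \<open>0 \<cdot> Kn 2\<close> at the largest \<open>p\<close>.\<close>

definition connected_summand_graphs :: "nat sgraph list" where
  "connected_summand_graphs =
     [Kn 1 \<oplus> Cn 4, complement (2 \<cdot> Pn 3), Kn 2 \<oplus> 2 \<cdot> Kn 2, Kn 1 \<oplus> (Kn 2 \<uplus> Pn 3)]"

definition no_isolated_graphs :: "nat sgraph list" where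
  "no_isolated_graphs = [Pn 3 \<uplus> Cn 4, Pn 3 \<uplus> (Kn 1 \<oplus> 2 \<cdot> Kn 2), 2 \<cdot> Pn 3 \<uplus> Kn 2]"

definition four_components_graphs :: "nat sgraph list" where
  "four_components_graphs =
     [3 \<cdot> Kn 1 \<uplus> (Kn 1 \<oplus> Cn 4), 1 \<cdot> Kn 1 \<uplus> 2 \<cdot> Kn 2 \<uplus> Kpq 1 1,
      2 \<cdot> Kn 1 \<uplus> 1 \<cdot> Kn 2 \<uplus> Kpq 2 2, 3 \<cdot> Kn 1 \<uplus> 0 \<cdot> Kn 2 \<uplus> Kpq 3 3]"

definition three_components_graphs :: "nat sgraph list" where
  "three_components_graphs =
     [2 \<cdot> Kn 1 \<uplus> complement (2 \<cdot> Pn 3),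
      2 \<cdot> Kn 1 \<uplus> (Kn 1 \<oplus> (Pn 3 \<uplus> Kn 2)),
      2 \<cdot> Kn 1 \<uplus> (Kn 2 \<oplus> 2 \<cdot> Kn 2),
      2 \<cdot> Kn 1 \<uplus> (Kn 1 \<oplus> (Cn 4 \<uplus> Kn 1)),
      2 \<cdot> Kn 1 \<uplus> (Kn 1 \<oplus> complement (Pn 3 \<uplus> Kn 2)),
      2 \<cdot> Kn 1 \<uplus> (complement (Kn 2) \<oplus> (Pn 3 \<uplus> Kn 1)),
      1 \<cdot> Kn 1 \<uplus> 1 \<cdot> Kn 2 \<uplus> (2 \<cdot> Kn 1 \<oplus> (Kn 2 \<uplus> 1 \<cdot> Kn 1)),
      2 \<cdot> Kn 1 \<uplus> 0 \<cdot> Kn 2 \<uplus> (2 \<cdot> Kn 1 \<oplus> (Kn 2 \<uplus> 2 \<cdot> Kn 1))]"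

definition two_components_graphs :: "nat sgraph list" where
  "two_components_graphs =
     [Kn 1 \<uplus> (Kn 1 \<oplus> (Kn 1 \<uplus> 2 \<cdot> Kn 2)),
      Kn 1 \<uplus> (Kn 1 \<oplus> (2 \<cdot> Kn 1 \<uplus> Cn 4)),
      Kn 1 \<uplus> (Kn 1 \<oplus> 2 \<cdot> Pn 3),
      Kn 1 \<uplus> (Kn 1 \<oplus> (Kn 1 \<uplus> complement (Kn 2 \<uplus> Pn 3)))]"

lemma list_sets:
  "connected_summands = set connected_summand_graphs"
  "no_isolated_list = set no_isolated_graphs"
  "four_components_list = set four_components_graphs"
  "three_components_list = set three_components_graphs"
  "two_components_list = set two_components_graphs"
proof -
  have image: "{f p | p. p \<in> A} = f ` A" for f :: "nat \<Rightarrow> nat sgraph" and A by blast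
  have diff: "3 - 1 = (2::nat)" "3 - 2 = (1::nat)" "2 - 1 = (1::nat)" by simp_all
  show "connected_summands = set connected_summand_graphs"
    by (simp only: connected_summands_def connected_summand_graphs_def list.set)
  show "no_isolated_list = set no_isolated_graphs"
    by (simp only: no_isolated_list_def no_isolated_graphs_def list.set)
  show "two_components_list = set two_components_graphs"
    by (simp only: two_components_list_def two_components_graphs_def list.set)
  show "four_components_list = set four_components_graphs"
    unfolding four_components_list_def four_components_graphs_def image
    by (simp only: image_insert image_empty list.set diff diff_self_eq_0 Un_insert_left Un_empty_left)
  show "three_components_list = set three_components_graphs"
    unfolding three_components_list_def three_components_graphs_def image
    by (simp only: image_insert image_empty list.set diff diff_self_eq_0 Un_insert_left Un_empty_left)
qed

lemma has_cotree_lists: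
  "list_all2 has_cotree summand_trees connected_summand_graphs"
  "list_all2 has_cotree no_isolated_trees no_isolated_graphs"
  "list_all2 has_cotree four_components_trees four_components_graphs"
  "list_all2 has_cotree three_components_trees three_components_graphs"
  "list_all2 has_cotree two_components_trees two_components_graphs"
  unfolding summand_trees_def no_isolated_trees_def four_components_trees_def
    three_components_trees_def two_components_trees_def connected_summand_graphs_def
    no_isolated_graphs_def four_components_graphs_def three_components_graphs_def
    two_components_graphs_def
  by (intro list.rel_intros has_cotree_intros)+

lemma has_cotree_summands:
  "list_all2 has_cotree (map (Par P3_tree) summand_trees) (map ((\<uplus>) (Pn 3)) connected_summand_graphs)"
  using has_cotree_lists(1)
  by (simp add: list_all2_map1 list_all2_map2)
    (auto elim!: list_all2_mono intro: has_cotree_disjoint_union[OF has_cotree_P3])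

lemma has_cotree_connected:
  "list_all2 has_cotree connected_trees (map (\<lambda>H. complement (Pn 3 \<uplus> H)) connected_summand_graphs)"
  using has_cotree_lists(1) unfolding connected_trees_def
  by (simp add: list_all2_map1 list_all2_map2 del: dual.simps)
    (auto simp del: dual.simps elim!: list_all2_mono
      intro: has_cotree_complement has_cotree_disjoint_union[OF has_cotree_P3])

section \<open>Matching the listed graphs with the computed obstructions\<close>

definition obstruction_graphs :: "nat sgraph list" where
  "obstruction_graphs = map (\<lambda>H. complement (Pn 3 \<uplus> H)) connected_summand_graphs @
     no_isolated_graphs @ four_components_graphs @ three_components_graphs @ two_components_graphs"

definition listed_trees :: "cotree list" where
  "listed_trees = connected_trees @ no_isolated_trees @ four_components_trees @
     three_components_trees @ two_components_trees"

lemma obstruction_list_set: "obstruction_list = set obstruction_graphs"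
  unfolding obstruction_list_def list_sets obstruction_graphs_def by (simp only: set_append set_map Un_assoc)

lemma has_cotree_listed: "list_all2 has_cotree listed_trees obstruction_graphs"
  unfolding listed_trees_def obstruction_graphs_def
  by (intro list_all2_appendI has_cotree_lists has_cotree_connected)

text \<open>Here the computed classification meets the stated list; both inclusions are
  evaluated.\<close>

lemma listed_trees_nf: "set (map cotree_nf listed_trees) = set obstruction_trees"
proof -
  have "list_all (\<lambda>t. t \<in> set obstruction_trees) (map cotree_nf listed_trees)"
    "list_all (\<lambda>t. t \<in> set (map cotree_nf listed_trees)) obstruction_trees"
    by code_simp+
  then show ?thesis unfolding list_all_iff by blast
qed

text \<open>Codes are computed on the cotrees. Their distinctness yields both the count 23 and,
  through invariance, pairwise non-isomorphism.\<close>

lemma obstruction_graphs_distinct: "distinct (map degree_code obstruction_graphs)"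
proof -
  have "map degree_code obstruction_graphs = map cotree_degree_code listed_trees"
    using has_cotree_listed
    by (induction rule: list_all2_induct) (simp_all add: has_cotree_degree_code)
  moreover have "distinct (map cotree_degree_code listed_trees)"
    by (simp add: cotree_degree_code_def listed_trees_def connected_trees_def summand_trees_def
        no_isolated_trees_def four_components_trees_def three_components_trees_def
        two_components_trees_def)
  ultimately show ?thesis by simp
qed

lemma isomorphic_degree_code:
  assumes "has_cotree t G" "G \<cong> H"
  shows "degree_code G = degree_code H"
  using assms isomorphic_has_cotree[OF assms(2)] has_cotree_degree_code by metis

text \<open>Some obstruction tree \<open>s\<close> is realized by \<open>G\<close>. If
  \<open>Q\<close> holds, then so does \<open>P s\<close>, which puts \<open>s\<close> into
  \<open>ts\<close>; conversely any realized \<open>t\<close> in \<open>ts\<close> satisfies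
  \<open>P\<close>. Thus each part of the theorem reduces to an evaluation over 23 trees.\<close>

lemma cotree_property_iff:
  assumes "list_all (\<lambda>t. P t \<longleftrightarrow> t \<in> set ts) obstruction_trees" "set ts \<subseteq> set obstruction_trees"
    and "s \<in> set obstruction_trees" "has_cotree s G" "\<And>t. has_cotree t G \<Longrightarrow> Q \<longleftrightarrow> P t"
  shows "Q \<longleftrightarrow> (\<exists>t\<in>set ts. has_cotree t G)"
  using assms unfolding list_all_iff by blast

text \<open>The connected case speaks of the complement of \<open>G\<close>, so there the normal
  form of the union with P3 is taken first and dualised afterwards.\<close>

lemma listed_trees_subset:
  "set (map dual (map cotree_nf (map (Par P3_tree) summand_trees))) \<subseteq> set obstruction_trees"
  "set (map cotree_nf no_isolated_trees) \<subseteq> set obstruction_trees"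
  "set (map cotree_nf four_components_trees) \<subseteq> set obstruction_trees"
  "set (map cotree_nf three_components_trees) \<subseteq> set obstruction_trees"
  "set (map cotree_nf two_components_trees) \<subseteq> set obstruction_trees"
proof -
  have "list_all (\<lambda>t. t \<in> set obstruction_trees) (map dual (map cotree_nf (map (Par P3_tree) summand_trees)))"
    by code_simp
  then show "set (map dual (map cotree_nf (map (Par P3_tree) summand_trees))) \<subseteq> set obstruction_trees"
    unfolding list_all_iff by blast
qed (auto simp flip: listed_trees_nf simp: listed_trees_def)

lemma listed_trees_properties:
  "list_all (\<lambda>t. num_components t = 1 \<longleftrightarrow>
     t \<in> set (map dual (map cotree_nf (map (Par P3_tree) summand_trees)))) obstruction_trees"
  "list_all (\<lambda>t. num_components t \<noteq> 1 \<and> num_isolated t = 0 \<longleftrightarrow>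
     t \<in> set (map cotree_nf no_isolated_trees)) obstruction_trees"
  "list_all (\<lambda>t. num_components t = 4 \<longleftrightarrow>
     t \<in> set (map cotree_nf four_components_trees)) obstruction_trees"
  "list_all (\<lambda>t. num_components t = 3 \<and> num_isolated t \<noteq> 0 \<longleftrightarrow>
     t \<in> set (map cotree_nf three_components_trees)) obstruction_trees"
  "list_all (\<lambda>t. num_components t = 2 \<and> num_isolated t = 1 \<longleftrightarrow>
     t \<in> set (map cotree_nf two_components_trees)) obstruction_trees"
  by code_simp+

theorem theorem10:
  fixes G :: "'a sgraph"
  assumes "simple_graph G"
  shows "(cograph_minimal_polar_obstruction \<infinity> 2 G \<longrightarrow>
            (connected_graph G \<longleftrightarrow> (\<exists>H\<in>connected_summands. complement G \<cong> Pn 3 \<uplus> H)) \<and>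
            (\<not> connected_graph G \<and> isolated_verts G = {} \<longleftrightarrow> (\<exists>H\<in>no_isolated_list. G \<cong> H)) \<and>
            (card (components G) = 4 \<longleftrightarrow> (\<exists>H\<in>four_components_list. G \<cong> H)) \<and>
            (card (components G) = 3 \<and> isolated_verts G \<noteq> {} \<longleftrightarrow>
               (\<exists>H\<in>three_components_list. G \<cong> H)) \<and>
            (card (components G) = 2 \<and> card (isolated_verts G) = 1 \<longleftrightarrow>
               (\<exists>H\<in>two_components_list. G \<cong> H))) \<and>
         (cograph_minimal_polar_obstruction \<infinity> 2 G \<longleftrightarrow> (\<exists>H\<in>obstruction_list. G \<cong> H)) \<and>
         card obstruction_list = 23 \<and>
         (\<forall>H\<in>obstruction_list. \<forall>H'\<in>obstruction_list. H \<cong> H' \<longrightarrow> H = H')"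
proof -
  have obstruction: "cograph_minimal_polar_obstruction \<infinity> 2 G \<longleftrightarrow>
      (\<exists>t\<in>set obstruction_trees. has_cotree t G)"
    unfolding has_cotree_def using assms by (rule obstruction_iff)
  have summands: "(\<exists>H\<in>connected_summands. complement G \<cong> Pn 3 \<uplus> H) \<longleftrightarrow>
      (\<exists>t\<in>set (map dual (map cotree_nf (map (Par P3_tree) summand_trees))). has_cotree t G)"
  proof -
    have "(\<exists>H\<in>connected_summands. complement G \<cong> Pn 3 \<uplus> H) \<longleftrightarrow>
        (\<exists>H\<in>set (map ((\<uplus>) (Pn 3)) connected_summand_graphs). complement G \<cong> H)"
      by (simp add: list_sets(1))
    also have "\<dots> \<longleftrightarrow>
        (\<exists>t\<in>set (map cotree_nf (map (Par P3_tree) summand_trees)). has_cotree (dual t) G)"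
      using isomorphic_normal_form[OF has_cotree_summands, of "complement G"]
      by (simp only: has_cotree_complement_iff[OF assms])
    finally show ?thesis by (simp only: set_map[of dual] bex_simps(7))
  qed
  note iso = has_cotree_lists(2-5)[THEN isomorphic_normal_form, of G, folded list_sets]
  have parts: "(connected_graph G \<longleftrightarrow> (\<exists>H\<in>connected_summands. complement G \<cong> Pn 3 \<uplus> H)) \<and>
      (\<not> connected_graph G \<and> isolated_verts G = {} \<longleftrightarrow> (\<exists>H\<in>no_isolated_list. G \<cong> H)) \<and>
      (card (components G) = 4 \<longleftrightarrow> (\<exists>H\<in>four_components_list. G \<cong> H)) \<and>
      (card (components G) = 3 \<and> isolated_verts G \<noteq> {} \<longleftrightarrow>
        (\<exists>H\<in>three_components_list. G \<cong> H)) \<and>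
      (card (components G) = 2 \<and> card (isolated_verts G) = 1 \<longleftrightarrow>
        (\<exists>H\<in>two_components_list. G \<cong> H))"
    if G: "cograph_minimal_polar_obstruction \<infinity> 2 G"
  proof -
    obtain s where s: "s \<in> set obstruction_trees" "has_cotree s G" using G obstruction by blast
    note inv = connected_graph_iff[OF assms] isolated_verts_empty_iff card_components[OF assms]
      card_isolated_verts
    \<comment> \<open>Each conjunct finds its instance through the tree list on its right-hand side;
      what remains is that the invariant of \<open>G\<close> agrees with the one computed on any of
      its cotrees.\<close>
    show ?thesis
      unfolding summands iso
      by (intro conjI; rule cotree_property_iff[OF listed_trees_properties(1) listed_trees_subset(1) s]
          cotree_property_iff[OF listed_trees_properties(2) listed_trees_subset(2) s]
          cotree_property_iff[OF listed_trees_properties(3) listed_trees_subset(3) s]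
          cotree_property_iff[OF listed_trees_properties(4) listed_trees_subset(4) s]
          cotree_property_iff[OF listed_trees_properties(5) listed_trees_subset(5) s];
          simp only: inv)
  qed
  have classification: "cograph_minimal_polar_obstruction \<infinity> 2 G \<longleftrightarrow> (\<exists>H\<in>obstruction_list. G \<cong> H)"
    unfolding obstruction obstruction_list_set
    using isomorphic_normal_form[OF has_cotree_listed, of G] by (simp only: listed_trees_nf)
  have "card obstruction_list = 23"
  proof -
    have "distinct obstruction_graphs" using obstruction_graphs_distinct by (simp add: distinct_map)
    then have "card obstruction_list = length obstruction_graphs"
      unfolding obstruction_list_set by (rule distinct_card)
    also have "\<dots> = 23"
      by (simp add: obstruction_graphs_def connected_summand_graphs_def no_isolated_graphs_def
          four_components_graphs_def three_components_graphs_def two_components_graphs_def)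
    finally show ?thesis .
  qed
  moreover have "H = H'" if "H \<in> obstruction_list" "H' \<in> obstruction_list" "H \<cong> H'" for H H'
  proof -
    have "\<exists>t. has_cotree t H"
      using that(1) has_cotree_listed unfolding obstruction_list_set
      by (metis in_set_conv_nth list_all2_conv_all_nth)
    then have "degree_code H = degree_code H'" using isomorphic_degree_code that(3) by blast
    moreover have "inj_on degree_code (set obstruction_graphs)"
      using obstruction_graphs_distinct by (simp add: distinct_map)
    ultimately show ?thesis using that(1,2) unfolding obstruction_list_set by (simp add: inj_on_def)
  qed
  ultimately show ?thesis using parts classification by blast
qed

end
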